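(* Let $G$ be a finite group. Then $G \cong \mathrm{PSL}(2,11)$ if and only if $\operatorname{Exp}_{\rho}(G) = \operatorname{Exp}_{\rho}(\mathrm{PSL}(2,11))$.
   Context: For a finite group $G$, $o(g)$ denotes the order of $g\in G$ and $\rho(G)=\prod_{g\in G} o(g)$ is the product of the element orders. If $n=p_1^{\alpha_1}\cdots p_k^{\alpha_k}$ with $p_1,\dots,p_k$ distinct primes and all $\alpha_i\ge 1$, then $\operatorname{Exp}(n)=\{\alpha_1,\dots,\alpha_k\}$, regarded as a set (repetitions are not recorded, nor is which exponent belongs to which prime). Set $\operatorname{Exp}_{\rho}(G)=\operatorname{Exp}(\rho(G))$. *)

theory Defs
  imports
    "HOL-Analysis.Finite_Cartesian_Product"
    "HOL-Analysis.Determinants"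
    "HOL-Library.Numeral_Type"
    "HOL-Algebra.Multiplicative_Group"
    "HOL-Computational_Algebra.Primes"
begin

definition element_order_prod :: "('a, 'b) monoid_scheme \<Rightarrow> nat" where
  "element_order_prod G = (\<Prod>g\<in>carrier G. group.ord G g)"

definition Exp :: "nat \<Rightarrow> nat set" where
  "Exp n = (\<lambda>p. multiplicity p n) ` prime_factors n"

definition Exp_rho :: "('a, 'b) monoid_scheme \<Rightarrow> nat set" where
  "Exp_rho G = Exp (element_order_prod G)"

definition group_center :: "('a, 'b) monoid_scheme \<Rightarrow> 'a set" where
  "group_center G =
    {z \<in> carrier G. \<forall>g\<in>carrier G. z \<otimes>\<^bsub>G\<^esub> g = g \<otimes>\<^bsub>G\<^esub> z}"

definition special_linear_group :: "('a::comm_ring_1 ^ 'n ^ 'n) monoid" where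
  "special_linear_group =
    \<lparr>carrier = {A. det A = 1}, mult = (**), one = mat 1\<rparr>"

definition projective_special_linear_group ::
    "('a::comm_ring_1 ^ 'n ^ 'n) set monoid" where
  "projective_special_linear_group =
    special_linear_group Mod group_center special_linear_group"

text \<open>
  The numeral type \<^typ>\<open>11\<close> carries arithmetic modulo 11, so it is the prime field
  with 11 elements (see \<open>inverse_mod_11\<close> below); \<^typ>\<open>11 ^ 2 ^ 2\<close> is the type of
  2 by 2 matrices over it.
\<close>

definition PSL_2_11 :: "(11 ^ 2 ^ 2) set monoid" where
  "PSL_2_11 = projective_special_linear_group"

lemma inverse_mod_11:
  fixes x :: 11
  assumes "x \<noteq> 0"
  shows "\<exists>y. x * y = 1"
proof (cases x)
  case (of_int z)
  have "prime (11::nat)"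
    by simp
  then have "prime (11::int)"
    by (metis of_nat_numeral prime_nat_int_transfer)
  moreover have "\<not> 11 dvd z"
    using of_int assms by (intro zdvd_not_zless) (auto simp: order_less_le)
  ultimately have "gcd 11 z = 1"
    by (simp add: prime_imp_coprime)
  then obtain u v where "u * 11 + v * z = 1"
    using bezout_int[of 11 z] by auto
  then have "of_int (u * 11 + v * z) = (1::11)"
    by simp
  moreover have "(11::11) = 0"
    by simp
  ultimately have "x * of_int v = 1"
    by (simp add: of_int(1) mult.commute)
  then show ?thesis ..
qed

lemma normal_group_center:
  fixes G (structure)
  assumes "group G"
  shows "group_center G \<lhd> G"
proof -
  interpret group G by fact
  have inv_comm: "inv z \<otimes> g = g \<otimes> inv z"
    if "z \<in> carrier G" "g \<in> carrier G" "z \<otimes> g = g \<otimes> z" for z g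
  proof -
    have "inv z \<otimes> g = inv z \<otimes> (g \<otimes> z) \<otimes> inv z"
      using that(1,2) by (simp add: m_assoc)
    also have "\<dots> = inv z \<otimes> (z \<otimes> g) \<otimes> inv z"
      using that by simp
    also have "\<dots> = g \<otimes> inv z"
      using that(1,2) by (simp add: m_assoc [symmetric])
    finally show ?thesis .
  qed
  have "subgroup (group_center G) G"
  proof (rule subgroupI)
    fix a b assume ab: "a \<in> group_center G" "b \<in> group_center G"
    have "a \<otimes> b \<otimes> g = g \<otimes> (a \<otimes> b)" if "g \<in> carrier G" for g
    proof -
      have [simp]: "a \<in> carrier G" "b \<in> carrier G" "g \<in> carrier G"
        using ab that by (auto simp: group_center_def)
      have "a \<otimes> b \<otimes> g = a \<otimes> (b \<otimes> g)"
        by (simp add: m_assoc)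
      also have "\<dots> = a \<otimes> (g \<otimes> b)"
        using ab(2) that by (simp add: group_center_def)
      also have "\<dots> = a \<otimes> g \<otimes> b"
        by (simp add: m_assoc)
      also have "\<dots> = g \<otimes> a \<otimes> b"
        using ab(1) that by (simp add: group_center_def)
      also have "\<dots> = g \<otimes> (a \<otimes> b)"
        by (simp add: m_assoc)
      finally show ?thesis .
    qed
    then show "a \<otimes> b \<in> group_center G"
      using ab unfolding group_center_def by blast
  next
    have "\<one> \<in> group_center G"
      by (simp add: group_center_def)
    then show "group_center G \<noteq> {}"
      by blast
  next
    fix a assume "a \<in> group_center G"
    then have "a \<in> carrier G" and "\<And>g. g \<in> carrier G \<Longrightarrow> a \<otimes> g = g \<otimes> a"
      unfolding group_center_def by blast+
    then show "inv a \<in> group_center G"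
      using inv_comm unfolding group_center_def by blast
  qed (unfold group_center_def, blast)
  moreover have "x \<otimes> h \<otimes> inv x \<in> group_center G"
    if "x \<in> carrier G" "h \<in> group_center G" for x h
  proof -
    have "h \<in> carrier G" and comm: "h \<otimes> x = x \<otimes> h"
      using that by (auto simp: group_center_def)
    then have "x \<otimes> h \<otimes> inv x = h"
      using that(1) by (simp add: comm [symmetric] m_assoc)
    then show ?thesis using that by simp
  qed
  ultimately show ?thesis by (simp add: normal_inv_iff)
qed

lemma group_special_linear_group_2:
  "group (special_linear_group :: ('a::comm_ring_1 ^ 2 ^ 2) monoid)"
proof (rule groupI)
  fix A :: "'a ^ 2 ^ 2"
  assume "A \<in> carrier special_linear_group"
  then have A: "A$1$1 * A$2$2 - A$1$2 * A$2$1 = 1"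
    by (simp add: special_linear_group_def det_2)
  define B :: "'a ^ 2 ^ 2" where
    "B = vector [vector [A$2$2, - (A$1$2)], vector [- (A$2$1), A$1$1]]"
  have "B ** A = mat 1"
    using A by (simp add: B_def vec_eq_iff forall_2 matrix_matrix_mult_def mat_def
        sum_2 algebra_simps)
  moreover have "det B = 1"
    using A by (simp add: B_def det_2 algebra_simps)
  ultimately show "\<exists>B\<in>carrier special_linear_group.
      B \<otimes>\<^bsub>special_linear_group\<^esub> A = \<one>\<^bsub>special_linear_group\<^esub>"
    by (auto simp: special_linear_group_def)
qed (auto simp: special_linear_group_def det_mul matrix_mul_assoc)

lemma group_PSL_2_11: "group PSL_2_11"
  unfolding PSL_2_11_def projective_special_linear_group_def
  by (intro normal.factorgroup_is_group normal_group_center group_special_linear_group_2)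

end

theory Submission
  imports Defs "HOL-Algebra.Sylow" "HOL-Algebra.Group_Action" "HOL-Number_Theory.Cong"
begin

text \<open>
  Let \<open>e\<^sub>p\<close> be the exponent of \<open>p\<close> in \<open>\<rho>(G)\<close>, that is the sum over \<open>g\<close> of the exponent of \<open>p\<close> in \<open>o(g)\<close>.
  For \<open>PSL(2,11)\<close>, where the order of an element is determined by its trace, counting matrices of given
  trace yields the set \<open>{120, 165, 220, 264}\<close>. Conversely let \<open>G\<close> have this set of exponents. Frobenius'
  theorem on the equation \<open>x\<^bsup>n\<^esup> = 1\<close>, applied in centralizers, shows that a power of a prime \<open>r\<close> dividing the
  order of \<open>G\<close> divides \<open>e\<^sub>p\<close> for every prime \<open>p\<close> other than \<open>r\<close>. The greatest common divisors of three of the four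
  numbers are 11, 4, 3 and 5, so the order is 330 or 660, and \<open>e\<^sub>5 = 264\<close>, \<open>e\<^sub>1\<^sub>1 = 120\<close>. Hence there are 1 or 12
  subgroups of order 11, and 1 is excluded by \<open>e\<^sub>5\<close>. With 12 of them, \<open>G\<close> acts doubly transitively and
  faithfully on them with point stabilizers of order 55, which determines the permutations, up to
  labelling, as translation \<open>x + 1\<close>, scaling \<open>4 x\<close> and inversion \<open>- 1 / x\<close> on the projective line over
  the field with 11 elements. So all groups with this set of exponents are isomorphic to one group of permutations.
\<close>

subsection \<open>Frobenius' theorem and element orders\<close>

text \<open>The exponent set does not tell which exponent belongs to which prime; divisibility has
  to recover this. Splitting each element into an r-part and a commuting r'-part y turns e_p, for p
  other than r, into a sum over the r'-elements y of the exponent of p in o(y) times the number of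
  r-elements centralizing y. By Frobenius' theorem in the centralizer, each conjugacy class of such
  y contributes a multiple of the r-part of the order. The exponent of r itself does change with the
  r-part, hence gcds of three numbers and not of four. The value 120 is then used as a count: as 121
  does not divide the order, e_11 is the number of elements of order divisible by 11, and 120 = 12 *
  10. The permutation group is only a meeting point: PSL(2,11) has the same exponents, so the same
  theorem, applied to it, identifies it with that group, in place of a computation with matrices
  acting on the projective line.\<close>

text \<open>An orbit contributes its length times \<open>c * f x\<close>, a multiple of orbit length
  times stabilizer order, which is \<open>order G\<close>. In the applications \<open>c\<close> is
  the part of the order prime to r, so that only the power of r is really asserted.\<close>

lemma (in group_action) order_dvd_weighted_sum:
  fixes f :: "'c \<Rightarrow> nat"
  assumes fin: "finite E"
    and inv: "\<And>g x. \<lbrakk>g \<in> carrier G; x \<in> E\<rbrakk> \<Longrightarrow> f (\<phi> g x) = f x"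
    and stab: "\<And>x. x \<in> E \<Longrightarrow> card (stabilizer G \<phi> x) dvd c * f x"
  shows "order G dvd c * (\<Sum>x\<in>E. f x)"
proof -
  have part: "partition E (orbits G E \<phi>)" by (rule orbit_partition)
  have "finite (orbits G E \<phi>)"
    using fin by (auto simp: orbits_def)
  then have "(\<Sum>x\<in>E. f x) = (\<Sum>A\<in>orbits G E \<phi>. \<Sum>x\<in>A. f x)"
    using Congruence.disjoint_sum[OF _ fin part] by metis
  moreover have "order G dvd c * (\<Sum>x\<in>A. f x)" if A: "A \<in> orbits G E \<phi>" for A
  proof -
    obtain x where x: "x \<in> E" "A = orbit G \<phi> x"
      using A unfolding orbits_def by blast
    have "(\<Sum>y\<in>A. f y) = (\<Sum>y\<in>A. f x)"
      using x inv by (intro sum.cong) (auto simp: orbit_def)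
    then have "c * (\<Sum>y\<in>A. f y) = card A * (c * f x)" by simp
    then show ?thesis
      using stab[OF x(1)] orbit_stabilizer_theorem[OF x(1)] x(2)
      by (metis dvd_refl mult_dvd_mono)
  qed
  ultimately show ?thesis
    by (simp add: dvd_sum sum_distrib_left)
qed

section \<open>Decomposition of elements into r-part and r'-part\<close>

definition centralizer :: "('a, 'b) monoid_scheme \<Rightarrow> 'a \<Rightarrow> 'a set" where
  "centralizer G y = {g \<in> carrier G. g \<otimes>\<^bsub>G\<^esub> y = y \<otimes>\<^bsub>G\<^esub> g}"

text \<open>A power equation, unlike a condition on \<open>ord\<close>, passes to a subgroup without
  comparing orders taken in two groups.\<close>

definition r_elements :: "nat \<Rightarrow> ('a, 'b) monoid_scheme \<Rightarrow> 'a set" where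
  "r_elements r G = {x \<in> carrier G. \<exists>k. x [^]\<^bsub>G\<^esub> (r ^ k :: nat) = \<one>\<^bsub>G\<^esub>}"

definition r'_elements :: "nat \<Rightarrow> ('a, 'b) monoid_scheme \<Rightarrow> 'a set" where
  "r'_elements r G = {x \<in> carrier G. coprime r (group.ord G x)}"

context group
begin

lemma conj_pow:
  assumes "g \<in> carrier G" "x \<in> carrier G"
  shows "(g \<otimes> x \<otimes> inv g) [^] (n::nat) = g \<otimes> x [^] n \<otimes> inv g"
proof (induction n)
  case (Suc n)
  have "(g \<otimes> x [^] n \<otimes> inv g) \<otimes> (g \<otimes> x \<otimes> inv g) = g \<otimes> x [^] n \<otimes> (inv g \<otimes> g) \<otimes> x \<otimes> inv g"
    using assms by (simp only: m_assoc m_closed inv_closed nat_pow_closed)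
  then show ?case using Suc assms by (simp add: m_assoc)
qed (use assms in simp)

lemma conj_eq_one_iff:
  assumes "g \<in> carrier G" "x \<in> carrier G"
  shows "g \<otimes> x \<otimes> inv g = \<one> \<longleftrightarrow> x = \<one>"
  using assms by (simp add: inv_solve_right' r_cancel_one)

lemma ord_conj:
  assumes "g \<in> carrier G" "x \<in> carrier G"
  shows "ord (g \<otimes> x \<otimes> inv g) = ord x"
  using assms by (subst ord_unique) (auto simp: conj_pow conj_eq_one_iff pow_eq_id)

lemma centralizer_subgroup:
  assumes "y \<in> carrier G" shows "subgroup (centralizer G y) G"
proof (rule subgroupI)
  fix a assume "a \<in> centralizer G y"
  then have a: "a \<in> carrier G" "a \<otimes> y = y \<otimes> a" by (auto simp: centralizer_def)
  have "inv a \<otimes> y = inv a \<otimes> (y \<otimes> a) \<otimes> inv a"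
    using a(1) assms by (simp add: m_assoc)
  also have "\<dots> = y \<otimes> inv a"
    using a(1) assms by (simp add: a(2)[symmetric] m_assoc[symmetric])
  finally show "inv a \<in> centralizer G y" using a(1) by (auto simp: centralizer_def)
next
  fix a b assume "a \<in> centralizer G y" "b \<in> centralizer G y"
  then show "a \<otimes> b \<in> centralizer G y" using assms
    by (auto simp: centralizer_def m_assoc) (metis m_assoc)
qed (use assms in \<open>auto simp: centralizer_def intro!: exI[of _ \<one>]\<close>)

lemma stabilizer_conjugation:
  assumes "y \<in> carrier G"
  shows "stabilizer G (\<lambda>g. \<lambda>h\<in>carrier G. g \<otimes> h \<otimes> inv g) y = centralizer G y"
  using assms by (auto simp: stabilizer_def centralizer_def inv_solve_right')

lemma conj_inv_cancel:
  assumes "g \<in> carrier G" "x \<in> carrier G"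
  shows "inv g \<otimes> (g \<otimes> x \<otimes> inv g) \<otimes> g = x" "g \<otimes> (inv g \<otimes> x \<otimes> g) \<otimes> inv g = x"
  using assms by (simp_all add: m_assoc) (simp_all add: m_assoc[symmetric])

lemma conj_mult:
  assumes "g \<in> carrier G" "x \<in> carrier G" "y \<in> carrier G"
  shows "(g \<otimes> x \<otimes> inv g) \<otimes> (g \<otimes> y \<otimes> inv g) = g \<otimes> (x \<otimes> y) \<otimes> inv g"
proof -
  have "inv g \<otimes> (g \<otimes> z) = z" if "z \<in> carrier G" for z
    using assms that by (simp add: m_assoc[symmetric])
  then show ?thesis using assms by (simp add: m_assoc)
qed

lemma bij_centralizer_conj:
  assumes g: "g \<in> carrier G" and y: "y \<in> carrier G"
  shows "bij_betw (\<lambda>x. g \<otimes> x \<otimes> inv g) (r_elements r G \<inter> centralizer G y)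
           (r_elements r G \<inter> centralizer G (g \<otimes> y \<otimes> inv g))"
proof (rule bij_betwI[where g = "\<lambda>x. inv g \<otimes> x \<otimes> g"])
  have closed: "h \<otimes> x \<otimes> inv h \<in> r_elements r G \<inter> centralizer G (h \<otimes> z \<otimes> inv h)"
    if "h \<in> carrier G" "z \<in> carrier G" "x \<in> r_elements r G \<inter> centralizer G z" for h x z
    using that by (auto simp: r_elements_def centralizer_def conj_pow conj_eq_one_iff conj_mult)
  show "(\<lambda>x. g \<otimes> x \<otimes> inv g) \<in> r_elements r G \<inter> centralizer G y \<rightarrow>
           r_elements r G \<inter> centralizer G (g \<otimes> y \<otimes> inv g)"
    using closed[OF g y] by blast
  show "(\<lambda>x. inv g \<otimes> x \<otimes> g) \<in> r_elements r G \<inter> centralizer G (g \<otimes> y \<otimes> inv g) \<rightarrow>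
           r_elements r G \<inter> centralizer G y"
    using closed[of "inv g" "g \<otimes> y \<otimes> inv g"] g y conj_inv_cancel[OF g y] by auto
qed (use g in \<open>auto simp: r_elements_def conj_inv_cancel\<close>)

lemma r_elements_subgroup:
  assumes "subgroup H G"
  shows "r_elements r (G\<lparr>carrier := H\<rparr>) = r_elements r G \<inter> H"
  using subgroup.subset[OF assms] by (auto simp: r_elements_def nat_pow_consistent[symmetric])

text \<open>The r-part of \<open>g\<close> is the power \<open>g [^] u\<close> for one exponent
  \<open>u\<close> that serves the whole group; being a power of \<open>g\<close>, it commutes with
  the complementary factor.\<close>

lemma r_decomposition:
  assumes fin: "finite (carrier G)" and r: "prime r"
  shows "bij_betw (\<lambda>(y, x). x \<otimes> y)
           (SIGMA y:r'_elements r G. r_elements r G \<inter> centralizer G y) (carrier G)"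
proof -
  have "order G > 0" using fin by (simp add: order_gt_0_iff_finite)
  then obtain a m where am: "order G = r ^ a * m" "\<not> r dvd m"
    using r by (metis multiplicity_decompose' not_prime_unit not_gr_zero)
  have cop: "coprime (r ^ a) m"
    using am(2) r by (simp add: prime_imp_coprime)
  \<comment> \<open>Raising to the power \<open>u\<close> fixes every r-element and kills every
    r'-element, so it projects a commuting product \<open>x \<otimes> y\<close> to
    \<open>x\<close>.\<close>
  obtain u where u: "[u = 1] (mod r ^ a)" "[u = 0] (mod m)"
    using binary_chinese_remainder_nat[OF cop] by blast
  have rx: "x [^] (r ^ a) = \<one>" if "x \<in> r_elements r G" for x
  proof -
    have x: "x \<in> carrier G" and "\<exists>k. ord x dvd r ^ k"
      using that by (auto simp: r_elements_def pow_eq_id)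
    then have "coprime (ord x) m"
      using am(2) r by (metis coprime_divisors coprime_power_left_iff dvd_refl prime_imp_coprime)
    then show ?thesis
      using ord_dvd_group_order[OF x] am(1) x
      by (simp add: pow_eq_id coprime_dvd_mult_left_iff)
  qed
  have ry: "y [^] m = \<one>" if "y \<in> r'_elements r G" for y
    using that ord_dvd_group_order[of y] am(1)
    by (auto simp: r'_elements_def pow_eq_id coprime_dvd_mult_right_iff coprime_commute)
  have xu: "x [^] u = x" if "x \<in> r_elements r G" for x
  proof -
    have x: "x \<in> carrier G" using that by (simp add: r_elements_def)
    have "ord x dvd r ^ a" using rx[OF that] x by (simp add: pow_eq_id)
    then have "[u = 1] (mod ord x)" using u(1) cong_dvd_modulus_nat by blast
    then have "x [^] int u = x [^] int 1"
      using x int_pow_eq[OF x] by (metis cong_iff_dvd_diff cong_int_iff cong_sym)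
    then show ?thesis using x by (simp add: int_pow_int)
  qed
  have yu: "y [^] u = \<one>" if "y \<in> r'_elements r G" for y
    using ry[OF that] that u(2)
    by (auto simp: r'_elements_def pow_eq_id cong_0_iff)
  have proj: "(x \<otimes> y) [^] u = x" if "y \<in> r'_elements r G" "x \<in> r_elements r G \<inter> centralizer G y" for x y
  proof -
    have "x \<in> carrier G" "y \<in> carrier G" "x \<otimes> y = y \<otimes> x"
      using that by (auto simp: centralizer_def r'_elements_def)
    then show ?thesis using xu[of x] yu[of y] that by (simp add: pow_mult_distrib)
  qed
  show ?thesis
  proof (rule bij_betw_imageI)
    show "inj_on (\<lambda>(y, x). x \<otimes> y) (SIGMA y:r'_elements r G. r_elements r G \<inter> centralizer G y)"
    proof (rule inj_onI, clarify)
      fix y x y' x'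
      assume 1: "y \<in> r'_elements r G" "x \<in> r_elements r G" "x \<in> centralizer G y"
        and 2: "y' \<in> r'_elements r G" "x' \<in> r_elements r G" "x' \<in> centralizer G y'"
        and eq: "x \<otimes> y = x' \<otimes> y'"
      then have "x = x'" using proj[of y x] proj[of y' x'] by simp
      moreover have "x \<in> carrier G" "y \<in> carrier G" "y' \<in> carrier G"
        using 1 2 by (auto simp: centralizer_def r'_elements_def)
      ultimately show "y = y' \<and> x = x'" using eq by simp
    qed
  next
    have "g \<in> (\<lambda>(y, x). x \<otimes> y) ` (SIGMA y:r'_elements r G. r_elements r G \<inter> centralizer G y)"
      if g: "g \<in> carrier G" for g
    proof -
      define x where "x = g [^] u"
      define y where "y = inv x \<otimes> g"
      have x: "x \<in> carrier G" and y: "y \<in> carrier G" using g by (auto simp: x_def y_def)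
      have xg: "x \<otimes> g = g \<otimes> x" using g by (simp add: x_def group_commutes_pow)
      have "g [^] (u * r ^ a) = \<one>"
        using pow_order_eq_1[OF g] u(2) am(1) g
        by (metis cong_0_iff dvd_refl mult.commute mult_dvd_mono nat_pow_pow nat_pow_one dvdE)
      then have "x [^] (r ^ a) = \<one>" using g by (simp add: x_def nat_pow_pow)
      then have xr: "x \<in> r_elements r G" using x by (auto simp: r_elements_def)
      have comm: "inv x \<otimes> g = g \<otimes> inv x"
        using xg x g by (metis inv_solve_left inv_solve_right m_assoc m_closed inv_closed)
      have "[u * m = 1 * m] (mod r ^ a * m)"
        using u(1) by (simp add: cong_def mod_mult_mult2)
      then have "g [^] (int u * int m) = g [^] int m"
        using int_pow_eq[OF g] ord_dvd_group_order[OF g] am(1)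
        by (metis cong_dvd_modulus_nat cong_iff_dvd_diff cong_int_iff cong_sym mult_1 of_nat_mult)
      then have "x [^] m = g [^] m"
        using g by (simp add: x_def nat_pow_pow int_pow_int flip: of_nat_mult)
      moreover have "y [^] m = inv (x [^] m) \<otimes> g [^] m"
        unfolding y_def using comm x g pow_mult_distrib[OF comm] by (simp add: nat_pow_inv)
      ultimately have "y [^] m = \<one>" using g by simp
      then have "ord y dvd m" using y by (simp add: pow_eq_id)
      then have "coprime r (ord y)"
        using am(2) r by (meson dvd_trans prime_imp_coprime)
      then have yr: "y \<in> r'_elements r G" using y by (simp add: r'_elements_def)
      have xy: "x \<otimes> y = g" using x g by (simp add: y_def m_assoc[symmetric])
      moreover have "y \<otimes> x = g" using x g comm by (simp add: y_def m_assoc)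
      ultimately have "x \<in> centralizer G y" using x by (simp add: centralizer_def)
      then show ?thesis using xr yr xy by (intro image_eqI[of _ _ "(y, x)"]) auto
    qed
    then show "(\<lambda>(y, x). x \<otimes> y) ` (SIGMA y:r'_elements r G. r_elements r G \<inter> centralizer G y) = carrier G"
      by (auto simp: r'_elements_def r_elements_def)
  qed
qed

end

section \<open>Frobenius' theorem and the exponents of the product of element orders\<close>

definition ord_exponent :: "nat \<Rightarrow> ('a, 'b) monoid_scheme \<Rightarrow> nat" where
  "ord_exponent p G = (\<Sum>g\<in>carrier G. multiplicity p (group.ord G g))"

context group
begin

lemma cauchy_subgroup:
  assumes H: "subgroup H G" and fin: "finite H" and p: "prime p" "p dvd card H"
  obtains x where "x \<in> H" "ord x = p"
proof -
  let ?H = "G\<lparr>carrier := H\<rparr>"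
  obtain k where k: "card H = p ^ 1 * k" using p by (auto elim: dvdE)
  have gH: "group ?H" using H by (rule subgroup_imp_group)
  \<comment> \<open>\<open>sylow_thm\<close> serves every power of a prime dividing the order, not
    only the largest; exponent 1 gives Cauchy's theorem.\<close>
  obtain K where K: "subgroup K ?H" "card K = p"
    using sylow_thm[OF p(1) gH, of 1 k] k fin by (auto simp: order_def)
  have KG: "subgroup K G" using H K(1) by (rule incl_subgroup)
  have "\<not> K \<subseteq> {\<one>}"
    using K(2) prime_gt_1_nat[OF p(1)] by (metis card.empty card_1_singleton_iff card_mono finite.emptyI finite.insertI leD is_singletonI is_singleton_altdef)
  then obtain x where x: "x \<in> K" "x \<noteq> \<one>" by auto
  have xG: "x \<in> carrier G" using KG x(1) by (rule subgroup.mem_carrier)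
  interpret KK: group "G\<lparr>carrier := K\<rparr>" using KG by (rule subgroup_imp_group)
  have "x [^] p = \<one>"
    using KK.pow_order_eq_1[of x] x(1) K(2) by (simp add: order_def flip: nat_pow_consistent)
  then have "ord x dvd p" using xG by (simp add: pow_eq_id)
  moreover have "ord x \<noteq> 1" using x(2) xG ord_eq_1 by simp
  ultimately have "ord x = p" using p(1) by (metis prime_nat_iff)
  moreover have "x \<in> H" using subgroup.subset[OF K(1)] x(1) by auto
  ultimately show thesis using that by blast
qed

lemma conj_central_iff:
  assumes "g \<in> carrier G" "y \<in> carrier G"
  shows "centralizer G (g \<otimes> y \<otimes> inv g) = carrier G \<longleftrightarrow> centralizer G y = carrier G"
proof -
  have *: "centralizer G (h \<otimes> z \<otimes> inv h) = carrier G"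
    if "h \<in> carrier G" "z \<in> carrier G" "centralizer G z = carrier G" for h z
  proof -
    have "h \<otimes> z = z \<otimes> h" using that by (auto simp: centralizer_def)
    then have "h \<otimes> z \<otimes> inv h = z" using that by (simp add: m_assoc)
    then show ?thesis using that by simp
  qed
  show ?thesis
    using *[of g y] *[of "inv g" "g \<otimes> y \<otimes> inv g"] assms conj_inv_cancel[OF assms] by auto
qed

lemma conj_r'_elements_iff:
  assumes "g \<in> carrier G" "y \<in> carrier G"
  shows "g \<otimes> y \<otimes> inv g \<in> r'_elements r G \<longleftrightarrow> y \<in> r'_elements r G"
  using assms by (simp add: r'_elements_def ord_conj)

lemma card_centralizer_conj:
  assumes "g \<in> carrier G" "y \<in> carrier G"
  shows "card (r_elements r G \<inter> centralizer G (g \<otimes> y \<otimes> inv g)) = card (r_elements r G \<inter> centralizer G y)"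
  using bij_betw_same_card[OF bij_centralizer_conj[OF assms]] by simp

text \<open>Closure under products: commuting factors give an order dividing the product of the two
  orders. Together with Cauchy's theorem this makes the number of central r'-elements prime to
  r.\<close>

lemma central_r'_elements_subgroup:
  "subgroup {y \<in> r'_elements r G. centralizer G y = carrier G} G"
proof (rule subgroupI)
  fix a assume a: "a \<in> {y \<in> r'_elements r G. centralizer G y = carrier G}"
  then have aG: "a \<in> carrier G" by (simp add: r'_elements_def)
  have "g \<otimes> inv a = inv a \<otimes> g" if "g \<in> carrier G" for g
  proof -
    have "g \<otimes> a = a \<otimes> g" using a that by (auto simp: centralizer_def)
    then show ?thesis using aG that
      by (metis inv_solve_left inv_solve_right m_assoc m_closed inv_closed)
  qed
  then have "centralizer G (inv a) = carrier G" unfolding centralizer_def by blast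
  then show "inv a \<in> {y \<in> r'_elements r G. centralizer G y = carrier G}"
    using a aG by (simp add: r'_elements_def)
next
  fix a b assume a: "a \<in> {y \<in> r'_elements r G. centralizer G y = carrier G}"
    and b: "b \<in> {y \<in> r'_elements r G. centralizer G y = carrier G}"
  have G: "a \<in> carrier G" "b \<in> carrier G" using a b by (simp_all add: r'_elements_def)
  have c: "g \<otimes> a = a \<otimes> g" "g \<otimes> b = b \<otimes> g" if "g \<in> carrier G" for g
    using a b that unfolding centralizer_def by blast+
  have "ord (a \<otimes> b) dvd ord a * ord b" using ord_mul_divides c G by blast
  then have "coprime r (ord (a \<otimes> b))"
    using a b by (auto simp: r'_elements_def intro: coprime_divisors)
  moreover
  have "g \<otimes> (a \<otimes> b) = a \<otimes> b \<otimes> g" if "g \<in> carrier G" for g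
    using c[OF that] G that by (metis m_assoc)
  then have "centralizer G (a \<otimes> b) = carrier G" unfolding centralizer_def by blast
  ultimately show "a \<otimes> b \<in> {y \<in> r'_elements r G. centralizer G y = carrier G}"
    using G by (simp add: r'_elements_def)
qed (auto simp: r'_elements_def centralizer_def intro!: exI[of _ \<one>])

lemma order_dvd_conj_invariant_sum:
  fixes f :: "'a \<Rightarrow> nat"
  assumes "finite (carrier G)"
    and "\<And>g y. \<lbrakk>g \<in> carrier G; y \<in> carrier G\<rbrakk> \<Longrightarrow> f (g \<otimes> y \<otimes> inv g) = f y"
    and "\<And>y. y \<in> carrier G \<Longrightarrow> card (centralizer G y) dvd c * f y"
  shows "order G dvd c * (\<Sum>y\<in>carrier G. f y)"
proof -
  interpret group_action G "carrier G" "\<lambda>g. \<lambda>h\<in>carrier G. g \<otimes> h \<otimes> inv g"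
    by (rule action_by_conjugation)
  show ?thesis
    by (rule order_dvd_weighted_sum) (use assms in \<open>simp_all add: stabilizer_conjugation\<close>)
qed

lemma order_eq_sum_centralizers:
  assumes "finite (carrier G)" "prime r"
  shows "order G = (\<Sum>y\<in>r'_elements r G. card (r_elements r G \<inter> centralizer G y))"
proof -
  have fin: "finite (r'_elements r G)" "\<And>y. finite (r_elements r G \<inter> centralizer G y)"
    using assms(1) by (auto simp: r'_elements_def r_elements_def)
  have "order G = card (SIGMA y:r'_elements r G. r_elements r G \<inter> centralizer G y)"
    using bij_betw_same_card[OF r_decomposition[OF assms]] by (simp add: order_def)
  then show ?thesis using fin by simp
qed

end

text \<open>Passes from \<open>order G = r ^ a * m\<close> to the order of a subgroup: its r'-part
  divides \<open>m\<close>, so a divisibility with that factor implies one with the factor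
  \<open>m\<close>.\<close>

lemma dvd_cofactor_prime_power:
  fixes r :: nat
  assumes "prime r" "n dvd r ^ a * m" "n \<noteq> 0"
  obtains b k where "n = r ^ b * k" "coprime r k" "k dvd m"
proof -
  obtain b k where bk: "n = r ^ b * k" "\<not> r dvd k"
    using assms by (metis multiplicity_decompose' not_prime_unit)
  then have cop: "coprime r k" using assms(1) by (simp add: prime_imp_coprime)
  have "k dvd r ^ a * m" using bk assms(2) by (metis dvd_mult_right)
  then have "k dvd m"
    using cop by (metis coprime_commute coprime_dvd_mult_right_iff coprime_power_right_iff)
  then show thesis using that bk cop by blast
qed

text \<open>Frobenius' theorem for the full power of \<open>r\<close> in the group order. In the equation given by the
  decomposition of elements into \<open>r\<close>-parts and \<open>r'\<close>-parts, the non-central \<open>r'\<close>-elements contribute a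
  multiple of this power by induction, and the central ones contribute the number sought times a
  number prime to \<open>r\<close>.\<close>

theorem order_dvd_card_r_elements:
  assumes "group G" "finite (carrier G)" "prime r" "order G = r ^ a * m" "coprime r m"
  shows "order G dvd m * card (r_elements r G)"
  using assms
proof (induction "order G" arbitrary: G a m rule: less_induct)
  case less
  interpret group G by fact
  let ?u = "card (r_elements r G)"
  define Z where "Z = {y \<in> r'_elements r G. centralizer G y = carrier G}"
  \<comment> \<open>Central elements get weight 0: their centralizer is all of \<open>G\<close>,
    which the induction hypothesis does not reach.\<close>
  define f where "f y = (if y \<in> r'_elements r G \<and> centralizer G y \<noteq> carrier G
    then card (r_elements r G \<inter> centralizer G y) else 0)" for y
  have pos: "order G > 0" using less.prems(2) by (simp add: order_gt_0_iff_finite)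
  have fin: "finite (r'_elements r G)" using less.prems(2) by (simp add: r'_elements_def)
  have ord_dvd: "order G dvd m * (\<Sum>y\<in>carrier G. f y)"
  proof (rule order_dvd_conj_invariant_sum)
    fix y assume y: "y \<in> carrier G"
    show "card (centralizer G y) dvd m * f y"
    proof (cases "centralizer G y = carrier G")
      case False
      let ?C = "centralizer G y"
      have sub: "subgroup ?C G" using y by (rule centralizer_subgroup)
      have CG: "?C \<subset> carrier G" using subgroup.subset[OF sub] False by auto
      have lt: "card ?C < order G"
        using CG less.prems(2) psubset_card_mono by (auto simp: order_def)
      have finC: "finite ?C" using CG less.prems(2) finite_subset by blast
      have nz: "card ?C \<noteq> 0" using finC sub subgroup.one_closed by auto
      have "card ?C dvd r ^ a * m" using lagrange[OF sub] less.prems(4) by (metis dvd_triv_right)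
      then obtain b k where bk: "card ?C = r ^ b * k" "coprime r k" "k dvd m"
        using dvd_cofactor_prime_power[OF less.prems(3)] nz by metis
      have "order (G\<lparr>carrier := ?C\<rparr>) dvd k * card (r_elements r (G\<lparr>carrier := ?C\<rparr>))"
        using less.hyps[of "G\<lparr>carrier := ?C\<rparr>" b k] lt bk finC subgroup_imp_group[OF sub] less.prems(3)
        by (simp add: order_def)
      then have "card ?C dvd m * card (r_elements r G \<inter> ?C)"
        using bk(3) by (simp add: order_def r_elements_subgroup[OF sub]) (meson dvd_trans mult_dvd_mono dvd_refl)
      then show ?thesis by (simp add: f_def)
    qed (simp add: f_def)
  qed (use less.prems(2) in \<open>auto simp: f_def conj_r'_elements_iff conj_central_iff card_centralizer_conj\<close>)
  have "(\<Sum>y\<in>carrier G. f y) = (\<Sum>y\<in>r'_elements r G - Z. card (r_elements r G \<inter> centralizer G y))"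
    unfolding f_def using less.prems(2)
    by (intro sum.mono_neutral_cong_right) (auto simp: Z_def r'_elements_def)
  moreover have "(\<Sum>y\<in>Z. card (r_elements r G \<inter> centralizer G y)) = card Z * ?u"
  proof -
    have "r_elements r G \<inter> centralizer G y = r_elements r G" if "y \<in> Z" for y
      using that by (auto simp: Z_def r_elements_def)
    then show ?thesis by simp
  qed
  moreover have "Z \<subseteq> r'_elements r G" by (auto simp: Z_def)
  ultimately have "order G = (\<Sum>y\<in>carrier G. f y) + card Z * ?u"
    using order_eq_sum_centralizers[OF less.prems(2,3)] fin by (simp add: sum.subset_diff)
  then have "m * order G = m * (\<Sum>y\<in>carrier G. f y) + m * (card Z * ?u)"
    by (metis distrib_left)
  then have "order G dvd m * (card Z * ?u)"
    using ord_dvd by (metis dvd_add_right_iff dvd_triv_right)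
  then have "r ^ a dvd card Z * ?u"
    using less.prems(4) pos by simp
  moreover have "coprime r (card Z)"
  proof (rule ccontr)
    assume "\<not> coprime r (card Z)"
    then have "r dvd card Z" using less.prems(3) prime_imp_coprime by blast
    moreover have "finite Z" using fin by (simp add: Z_def)
    moreover have "subgroup Z G" unfolding Z_def by (rule central_r'_elements_subgroup)
    ultimately obtain x where "x \<in> Z" "ord x = r"
      using cauchy_subgroup less.prems(3) by metis
    then have "coprime r r" by (simp add: Z_def r'_elements_def)
    then show False using less.prems(3) by simp
  qed
  ultimately have "r ^ a dvd ?u" by (simp add: coprime_dvd_mult_right_iff)
  then show ?case using less.prems(4) by (metis mult.commute mult_dvd_mono dvd_refl)
qed

context group
begin

text \<open>Frobenius' theorem inside the centralizer, with its own cofactor enlarged to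
  \<open>m\<close>, so that one multiplier serves all \<open>y\<close>.\<close>

lemma card_centralizer_dvd:
  assumes "finite (carrier G)" "prime r" "order G = r ^ a * m" "y \<in> carrier G"
  shows "card (centralizer G y) dvd m * card (r_elements r G \<inter> centralizer G y)"
proof -
  let ?C = "centralizer G y"
  have sub: "subgroup ?C G" using assms(4) by (rule centralizer_subgroup)
  have finC: "finite ?C" using subgroup.subset[OF sub] assms(1) finite_subset by blast
  have nz: "card ?C \<noteq> 0" using finC sub subgroup.one_closed by auto
  have "card ?C dvd r ^ a * m" using lagrange[OF sub] assms(3) by (metis dvd_triv_right)
  then obtain b k where bk: "card ?C = r ^ b * k" "coprime r k" "k dvd m"
    using dvd_cofactor_prime_power[OF assms(2)] nz by metis
  have "order (G\<lparr>carrier := ?C\<rparr>) dvd k * card (r_elements r (G\<lparr>carrier := ?C\<rparr>))"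
    using order_dvd_card_r_elements[of "G\<lparr>carrier := ?C\<rparr>" r b k] bk finC subgroup_imp_group[OF sub] assms(2)
    by (simp add: order_def)
  then show ?thesis
    using bk(3) by (simp add: order_def r_elements_subgroup[OF sub]) (meson dvd_trans mult_dvd_mono dvd_refl)
qed

text \<open>The orders of \<open>x \<otimes> y\<close> and \<open>y\<close> divide each other up to
  a power of \<open>r\<close>, which is invisible to \<open>p\<close>.\<close>

lemma multiplicity_ord_mult_r_element:
  assumes "prime p" "prime r" "p \<noteq> r" "x \<in> r_elements r G" "y \<in> r'_elements r G" "x \<in> centralizer G y"
    and fin: "finite (carrier G)"
  shows "multiplicity p (ord (x \<otimes> y)) = multiplicity p (ord y)"
proof -
  have G: "x \<in> carrier G" "y \<in> carrier G" "x \<otimes> y = y \<otimes> x"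
    using assms by (auto simp: r_elements_def r'_elements_def centralizer_def)
  obtain k where k: "x [^] (r ^ k) = \<one>" using assms by (auto simp: r_elements_def)
  have nz: "ord z > 0" if "z \<in> carrier G" for z using ord_ge_1[OF fin that] by simp
  have "ord (x \<otimes> y) dvd r ^ k * ord y"
    using G k by (simp add: pow_mult_distrib flip: pow_eq_id nat_pow_pow)
      (metis G(2) mult.commute nat_pow_one nat_pow_pow pow_ord_eq_1)
  moreover have "(y [^] ord (x \<otimes> y)) [^] (r ^ k) = \<one>"
  proof -
    have "(x \<otimes> y) [^] (ord (x \<otimes> y) * r ^ k) = \<one>"
      using G by (metis m_closed nat_pow_one nat_pow_pow pow_ord_eq_1)
    then have "x [^] (ord (x \<otimes> y) * r ^ k) \<otimes> y [^] (ord (x \<otimes> y) * r ^ k) = \<one>"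
      using pow_mult_distrib[OF G(3,1,2)] by simp
    moreover have "x [^] (ord (x \<otimes> y) * r ^ k) = \<one>"
      using G k by (metis mult.commute nat_pow_one nat_pow_pow)
    ultimately show ?thesis using G by (simp add: nat_pow_pow)
  qed
  then have "ord y dvd ord (x \<otimes> y) * r ^ k" using G by (simp add: nat_pow_pow pow_eq_id)
  moreover have "multiplicity p (r ^ k * c) = multiplicity p c" if "c > 0" for c
    using assms(1-3) that
    by (subst prime_elem_multiplicity_mult_distrib) (auto simp: multiplicity_distinct_prime_power)
  ultimately show ?thesis
    using nz G assms(2) by (metis dvd_imp_multiplicity_le le_antisym m_closed mult.commute mult_pos_pos prime_gt_0_nat zero_less_power less_numeral_extra(3) gr_implies_not0)
qed

text \<open>The exponent of \<open>p\<close> depends only on the r'-part, so the sum over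
  \<open>G\<close> collapses to \<open>r'_elements\<close>, weighted by fibre sizes;
  \<open>card_centralizer_dvd\<close> is the stabilizer condition for conjugation.\<close>

theorem order_dvd_ord_exponent:
  assumes fin: "finite (carrier G)" and pr: "prime p" "prime r" "p \<noteq> r" and m: "order G = r ^ a * m"
  shows "order G dvd m * ord_exponent p G"
proof -
  define f where "f y = (if y \<in> r'_elements r G
    then multiplicity p (ord y) * card (r_elements r G \<inter> centralizer G y) else 0)" for y
  have fin': "finite (r'_elements r G)" "\<And>y. finite (r_elements r G \<inter> centralizer G y)"
    using fin by (auto simp: r'_elements_def r_elements_def)
  have "ord_exponent p G = (\<Sum>(y, x)\<in>(SIGMA y:r'_elements r G. r_elements r G \<inter> centralizer G y).
      multiplicity p (ord (x \<otimes> y)))"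
    unfolding ord_exponent_def
    by (subst sum.reindex_bij_betw[OF r_decomposition[OF fin pr(2)], symmetric])
      (simp add: case_prod_unfold)
  also have "\<dots> = (\<Sum>(y, x)\<in>(SIGMA y:r'_elements r G. r_elements r G \<inter> centralizer G y).
      multiplicity p (ord y))"
    by (intro sum.cong) (auto simp: multiplicity_ord_mult_r_element[OF pr _ _ _ fin])
  also have "\<dots> = (\<Sum>y\<in>r'_elements r G. \<Sum>x\<in>r_elements r G \<inter> centralizer G y. multiplicity p (ord y))"
    using fin' by (subst sum.Sigma) auto
  also have "\<dots> = (\<Sum>y\<in>r'_elements r G. f y)"
    by (simp add: f_def mult.commute)
  also have "\<dots> = (\<Sum>y\<in>carrier G. f y)"
    using fin by (intro sum.mono_neutral_left) (auto simp: f_def r'_elements_def)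
  finally have eq: "ord_exponent p G = (\<Sum>y\<in>carrier G. f y)" .
  show ?thesis unfolding eq
  proof (rule order_dvd_conj_invariant_sum[OF fin])
    fix y assume y: "y \<in> carrier G"
    show "card (centralizer G y) dvd m * f y"
      using dvd_mult[OF card_centralizer_dvd[OF fin pr(2) m y], of "multiplicity p (ord y)"]
      by (simp add: f_def mult.left_commute)
  qed (auto simp: f_def conj_r'_elements_iff ord_conj card_centralizer_conj)
qed

corollary prime_power_dvd_ord_exponent:
  assumes "finite (carrier G)" "prime p" "prime r" "p \<noteq> r" "r ^ a dvd order G"
  shows "r ^ a dvd ord_exponent p G"
proof -
  have "order G > 0" using assms(1) by (simp add: order_gt_0_iff_finite)
  obtain m where m: "order G = r ^ a * m" using assms(5) by (auto elim: dvdE)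
  then have "r ^ a * m dvd m * ord_exponent p G"
    using order_dvd_ord_exponent[OF assms(1-4) m] by simp
  then show ?thesis using \<open>order G > 0\<close> m by (simp add: mult.commute)
qed

lemma multiplicity_element_order_prod:
  assumes "finite (carrier G)" "prime p"
  shows "multiplicity p (element_order_prod G) = ord_exponent p G"
  unfolding element_order_prod_def ord_exponent_def
proof (rule prime_elem_multiplicity_prod_distrib)
  show "0 \<notin> ord ` carrier G"
    using ord_ge_1[OF assms(1)] by (metis imageE not_one_le_zero)
qed (use assms in simp_all)

lemma Exp_rho_eq:
  assumes "finite (carrier G)"
  shows "Exp_rho G = {ord_exponent p G | p. prime p \<and> ord_exponent p G > 0}"
proof -
  have nz: "element_order_prod G \<noteq> 0"
    using assms ord_ge_1[OF assms] unfolding element_order_prod_def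
    by (metis not_one_le_zero prod_zero_iff)
  have "p \<in> prime_factors (element_order_prod G) \<longleftrightarrow> prime p \<and> ord_exponent p G > 0" for p
    using nz by (auto simp: prime_factors_multiplicity multiplicity_element_order_prod[OF assms, symmetric])
  then show ?thesis
    unfolding Exp_rho_def Exp_def
    by (auto simp: image_iff multiplicity_element_order_prod[OF assms])
qed

lemma ord_exponent_pos_imp_dvd:
  assumes "finite (carrier G)" "prime p" "ord_exponent p G > 0"
  shows "p dvd order G"
proof -
  obtain g where g: "g \<in> carrier G" "multiplicity p (ord g) > 0"
    using assms(3) unfolding ord_exponent_def by (metis neq0_conv sum.neutral)
  then have "p dvd ord g" by (metis not_dvd_imp_multiplicity_0 less_irrefl)
  then show ?thesis using ord_dvd_group_order[OF g(1)] by (rule dvd_trans)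
qed

text \<open>The primes \<open>p1\<close>, ..., \<open>p4\<close> are named by their exponents 120,
  165, 220, 264 and turn out to be 11, 2, 3, 5. Only the gcd for 2, namely 4, is not itself a prime,
  which leaves the two orders.\<close>

lemma order_of_Exp_rho:
  assumes fin: "finite (carrier G)" and Exp: "Exp_rho G = {120, 165, 220, 264}"
  shows "order G \<in> {330, 660}" "ord_exponent 5 G = 264" "ord_exponent 11 G = 120"
proof -
  have "\<exists>p. prime p \<and> ord_exponent p G = n" if "n \<in> {120, 165, 220, 264}" for n
    using that unfolding Exp[symmetric] Exp_rho_eq[OF fin] by blast
  then obtain p1 p2 p3 p4
    where p: "prime p1" "ord_exponent p1 G = 120" "prime p2" "ord_exponent p2 G = 165"
      "prime p3" "ord_exponent p3 G = 220" "prime p4" "ord_exponent p4 G = 264"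
    by (metis insertCI)
  have pdvd: "p1 dvd order G" "p2 dvd order G" "p3 dvd order G" "p4 dvd order G"
    using ord_exponent_pos_imp_dvd[OF fin] p by simp_all
  define v where "v r = multiplicity r (order G)" for r
  have pos: "order G > 0" using fin by (simp add: order_gt_0_iff_finite)
  have v: "r ^ v r dvd ord_exponent p G" if "prime p" "prime r" "p \<noteq> r" for r p
    using prime_power_dvd_ord_exponent[OF fin that] by (simp add: v_def multiplicity_dvd)
  have vpos: "v r > 0" if "prime r" "r dvd order G" for r
    using that pos by (simp add: v_def prime_multiplicity_gt_zero_iff)
  have rdvd: "r dvd r ^ v r" if "prime r" "r dvd order G" for r
    using vpos[OF that] by (simp add: dvd_power)
  have gcds: "gcd (gcd 165 220) 264 = (11::nat)" "gcd (gcd 120 220) 264 = (4::nat)"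
    "gcd (gcd 120 165) 264 = (3::nat)" "gcd (gcd 120 165) 220 = (5::nat)"
    by (simp_all add: gcd_nat.simps)
  \<comment> \<open>The exponent of \<open>p1\<close> itself is left out, since the divisibility
    concerns two different primes; the primes differ because their exponents do.\<close>
  have "p1 ^ v p1 dvd gcd (gcd 165 220) 264"
    using v[OF p(3) p(1)] v[OF p(5) p(1)] v[OF p(7) p(1)] p by fastforce
  then have d1: "p1 ^ v p1 dvd 11" unfolding gcds .
  have "p2 ^ v p2 dvd gcd (gcd 120 220) 264"
    using v[OF p(1) p(3)] v[OF p(5) p(3)] v[OF p(7) p(3)] p by fastforce
  then have d2: "p2 ^ v p2 dvd 4" unfolding gcds .
  have "p3 ^ v p3 dvd gcd (gcd 120 165) 264"
    using v[OF p(1) p(5)] v[OF p(3) p(5)] v[OF p(7) p(5)] p by fastforce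
  then have d3: "p3 ^ v p3 dvd 3" unfolding gcds .
  have "p4 ^ v p4 dvd gcd (gcd 120 165) 220"
    using v[OF p(1) p(7)] v[OF p(3) p(7)] v[OF p(5) p(7)] p by fastforce
  then have d4: "p4 ^ v p4 dvd 5" unfolding gcds .
  have primes: "prime (11::nat)" "prime (3::nat)" "prime (5::nat)" "prime (2::nat)" by simp_all
  have "p1 dvd 11" using d1 rdvd[OF p(1) pdvd(1)] dvd_trans by blast
  then have p1: "p1 = 11" using p(1) primes by (metis primes_dvd_imp_eq)
  have "p3 dvd 3" using d3 rdvd[OF p(5) pdvd(3)] dvd_trans by blast
  then have p3: "p3 = 3" using p(5) primes by (metis primes_dvd_imp_eq)
  have "p4 dvd 5" using d4 rdvd[OF p(7) pdvd(4)] dvd_trans by blast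
  then have p4: "p4 = 5" using p(7) primes by (metis primes_dvd_imp_eq)
  have "p2 dvd 4" using d2 rdvd[OF p(3) pdvd(2)] dvd_trans by blast
  then have "p2 dvd 2 ^ 2" by simp
  then have p2: "p2 = 2" using p(3) primes by (metis prime_dvd_power primes_dvd_imp_eq)
  have le1: "v q = 1" if q: "prime q" "q dvd order G" "q ^ v q dvd q" for q
  proof -
    have "q ^ v q dvd q ^ 1" using q(3) by simp
    then have "v q \<le> 1" using prime_ge_2_nat[OF q(1)] dvd_power_iff_le by blast
    then show ?thesis using vpos[OF q(1,2)] by simp
  qed
  have v1: "v 11 = 1" "v 3 = 1" "v 5 = 1"
    using le1[of 11] le1[of 3] le1[of 5] p pdvd d1 d3 d4 unfolding p1 p3 p4 by blast+
  have "2 ^ v 2 dvd (2::nat) ^ 2" using d2 p2 by simp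
  then have "v 2 \<le> 2" using dvd_power_iff_le by blast
  then have v2: "v 2 = 1 \<or> v 2 = 2" using vpos[OF p(3) pdvd(2)] p2 by auto
  \<comment> \<open>A further prime divisor would divide all four exponents, whose gcd is 1.\<close>
  have "prime_factors (order G) = {2, 3, 5, 11}"
  proof (intro equalityI subsetI)
    fix r assume "r \<in> prime_factors (order G)"
    then have r: "prime r" "r dvd order G" by auto
    show "r \<in> {2, 3, 5, 11}"
    proof (rule ccontr)
      assume "r \<notin> {2, 3, 5, 11}"
      then have "r dvd 120" "r dvd 165" "r dvd 220" "r dvd 264"
        using v[OF _ r(1)] rdvd[OF r] p p1 p2 p3 p4 by (metis dvd_trans insertCI)+
      then have "r dvd gcd (gcd (gcd 120 165) 220) 264" by simp
      moreover have "gcd (gcd (gcd 120 165) 220) 264 = (1::nat)"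
        by (simp add: gcd_nat.simps)
      ultimately show False using r(1) by (metis nat_dvd_1_iff_1 not_prime_1)
    qed
  qed (use pdvd p1 p2 p3 p4 p pos in \<open>auto simp: in_prime_factors_iff\<close>)
  then have "order G = 2 ^ v 2 * 3 ^ v 3 * 5 ^ v 5 * 11 ^ v 11"
    using prime_factorization_nat[OF pos] by (simp add: v_def)
  then show "order G \<in> {330, 660}" using v1 v2 by auto
  show "ord_exponent 5 G = 264" "ord_exponent 11 G = 120" using p p1 p4 by simp_all
qed

end

subsection \<open>Conjugates and normalizers of subgroups\<close>

definition conj_set :: "('a, 'b) monoid_scheme \<Rightarrow> 'a \<Rightarrow> 'a set \<Rightarrow> 'a set" where
  "conj_set G g K = (\<lambda>x. g \<otimes>\<^bsub>G\<^esub> x \<otimes>\<^bsub>G\<^esub> inv\<^bsub>G\<^esub> g) ` K"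

definition set_normalizer :: "('a, 'b) monoid_scheme \<Rightarrow> 'a set \<Rightarrow> 'a set" where
  "set_normalizer G K = {g \<in> carrier G. conj_set G g K = K}"

context group
begin

lemma conj_set_one: "K \<subseteq> carrier G \<Longrightarrow> conj_set G \<one> K = K"
  by (force simp: conj_set_def)

lemma conj_set_mult:
  assumes "g \<in> carrier G" "h \<in> carrier G" "K \<subseteq> carrier G"
  shows "conj_set G (g \<otimes> h) K = conj_set G g (conj_set G h K)"
  unfolding conj_set_def image_image
  using assms by (intro image_cong) (auto simp: m_assoc inv_mult_group subset_iff)

lemma conj_set_subset: "g \<in> carrier G \<Longrightarrow> K \<subseteq> carrier G \<Longrightarrow> conj_set G g K \<subseteq> carrier G"
  by (auto simp: conj_set_def)

lemma conj_set_inv: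
  assumes "g \<in> carrier G" "K \<subseteq> carrier G"
  shows "conj_set G (inv g) (conj_set G g K) = K" "conj_set G g (conj_set G (inv g) K) = K"
  using assms conj_set_mult[of "inv g" g K] conj_set_mult[of g "inv g" K] by (simp_all add: conj_set_one)

lemma inj_conj: "g \<in> carrier G \<Longrightarrow> inj_on (\<lambda>x. g \<otimes> x \<otimes> inv g) (carrier G)"
  by (intro inj_onI) (metis conj_inv_cancel(1))

lemma card_conj_set: "g \<in> carrier G \<Longrightarrow> K \<subseteq> carrier G \<Longrightarrow> card (conj_set G g K) = card K"
  unfolding conj_set_def using inj_on_subset[OF inj_conj] by (intro card_image) blast

lemma subgroup_conj_set:
  assumes "g \<in> carrier G" "subgroup K G"
  shows "subgroup (conj_set G g K) G"
proof -
  have KG: "K \<subseteq> carrier G" using assms(2) by (rule subgroup.subset)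
  show ?thesis
  proof (rule subgroupI)
    show "conj_set G g K \<subseteq> carrier G" using assms(1) KG by (rule conj_set_subset)
    show "conj_set G g K \<noteq> {}" using subgroup.one_closed[OF assms(2)] by (auto simp: conj_set_def)
  next
    fix a assume "a \<in> conj_set G g K"
    then obtain x where x: "x \<in> K" "a = g \<otimes> x \<otimes> inv g" by (auto simp: conj_set_def)
    then have "inv a = g \<otimes> inv x \<otimes> inv g"
      using assms(1) KG by (auto simp: inv_mult_group m_assoc subset_iff)
    then show "inv a \<in> conj_set G g K"
      using x(1) subgroup.m_inv_closed[OF assms(2)] unfolding conj_set_def by blast
  next
    fix a b assume "a \<in> conj_set G g K" "b \<in> conj_set G g K"
    then obtain x y where x: "x \<in> K" "a = g \<otimes> x \<otimes> inv g" and y: "y \<in> K" "b = g \<otimes> y \<otimes> inv g"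
      by (auto simp: conj_set_def)
    then have "a \<otimes> b = g \<otimes> (x \<otimes> y) \<otimes> inv g"
      using assms(1) KG conj_mult[of g x y] by (auto simp: subset_iff)
    then show "a \<otimes> b \<in> conj_set G g K"
      using x(1) y(1) subgroup.m_closed[OF assms(2)] unfolding conj_set_def by blast
  qed
qed

lemma subgroup_set_normalizer:
  assumes "K \<subseteq> carrier G"
  shows "subgroup (set_normalizer G K) G"
proof (rule subgroupI)
  fix a b assume "a \<in> set_normalizer G K" "b \<in> set_normalizer G K"
  then show "a \<otimes> b \<in> set_normalizer G K"
    using assms by (simp add: set_normalizer_def conj_set_mult)
next
  fix a assume "a \<in> set_normalizer G K"
  then show "inv a \<in> set_normalizer G K"
    using assms conj_set_inv(1)[of a K] by (simp add: set_normalizer_def)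
qed (use assms conj_set_one in \<open>auto simp: set_normalizer_def\<close>)

lemma subset_set_normalizer:
  assumes "subgroup K G"
  shows "K \<subseteq> set_normalizer G K"
proof
  fix g assume g: "g \<in> K"
  have KG: "K \<subseteq> carrier G" using assms by (rule subgroup.subset)
  have sub: "conj_set G h K \<subseteq> K" if "h \<in> K" for h
    using that assms by (auto simp: conj_set_def intro!: subgroup.m_closed subgroup.m_inv_closed)
  have "K = conj_set G g (conj_set G (inv g) K)"
    using conj_set_inv(2)[of g K] g KG by auto
  also have "\<dots> \<subseteq> conj_set G g K"
    using sub[of "inv g"] g assms unfolding conj_set_def[of G g] by (intro image_mono) (auto intro: subgroup.m_inv_closed)
  finally show "g \<in> set_normalizer G K"
    using sub[OF g] g KG by (auto simp: set_normalizer_def)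
qed

text \<open>The index is the order of the quotient group, where every element raised to that order
  is trivial.\<close>

lemma pow_index_mem_normal:
  assumes "K \<lhd> (G\<lparr>carrier := N\<rparr>)" "subgroup N G" "finite N" "x \<in> N"
  shows "x [^] (card N div card K) \<in> K"
proof -
  let ?N = "G\<lparr>carrier := N\<rparr>"
  interpret K: normal K ?N by fact
  have KN: "subgroup K ?N" by (rule K.subgroup_axioms)
  interpret Q: group "?N Mod K" by (rule K.factorgroup_is_group)
  have fin: "finite K" using finite_subset[OF subgroup.subset[OF KN]] assms(3) by simp
  have "card K > 0" using fin subgroup.one_closed[OF KN] by (auto simp: card_gt_0_iff)
  moreover have "order (?N Mod K) * card K = card N"
    using K.lagrange[OF KN] by (simp add: order_def FactGroup_def)
  ultimately have m: "order (?N Mod K) = card N div card K"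
    by (metis div_mult_self_is_m)
  have "K #>\<^bsub>?N\<^esub> x \<in> carrier (?N Mod K)"
    using assms(4) by (auto simp: FactGroup_def RCOSETS_def)
  then have "(K #>\<^bsub>?N\<^esub> x) [^]\<^bsub>?N Mod K\<^esub> order (?N Mod K) = \<one>\<^bsub>?N Mod K\<^esub>"
    by (rule Q.pow_order_eq_1)
  then have "K #>\<^bsub>?N\<^esub> (x [^]\<^bsub>?N\<^esub> order (?N Mod K)) = K"
    using hom_nat_pow[OF K.r_coset_hom_Mod _ K.is_group Q.is_group, of x "order (?N Mod K)"] assms(4)
    by (simp add: FactGroup_def)
  moreover have "x [^]\<^bsub>?N\<^esub> order (?N Mod K) \<in> carrier ?N"
    by (rule K.nat_pow_closed) (simp add: assms(4))
  ultimately have "x [^]\<^bsub>?N\<^esub> order (?N Mod K) \<in> K"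
    by (rule K.coset_join1[OF _ _ KN])
  moreover have "x [^]\<^bsub>?N\<^esub> order (?N Mod K) = x [^] (card N div card K)"
    unfolding m by (rule nat_pow_consistent[symmetric])
  ultimately show ?thesis by (rule back_subst[of "\<lambda>y. y \<in> K"])
qed

lemma pow_index_mem_set_normalizer:
  assumes "subgroup K G" "finite (carrier G)" "x \<in> set_normalizer G K"
  shows "x [^] (card (set_normalizer G K) div card K) \<in> K"
proof -
  let ?N = "set_normalizer G K"
  have KG: "K \<subseteq> carrier G" using assms(1) by (rule subgroup.subset)
  have N: "subgroup ?N G" using KG by (rule subgroup_set_normalizer)
  interpret NN: group "G\<lparr>carrier := ?N\<rparr>" using N by (rule subgroup_imp_group)
  have "subgroup K (G\<lparr>carrier := ?N\<rparr>)"
    using assms(1) N subset_set_normalizer[OF assms(1)] by (rule subgroup_incl)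
  moreover have "g \<otimes> k \<otimes> inv g \<in> K" if "g \<in> ?N" "k \<in> K" for g k
    using that unfolding set_normalizer_def conj_set_def by blast
  ultimately have "K \<lhd> (G\<lparr>carrier := ?N\<rparr>)"
    using N by (subst NN.normal_inv_iff) (auto simp: m_inv_consistent)
  moreover have "finite ?N" using assms(2) by (simp add: set_normalizer_def)
  ultimately show ?thesis using pow_index_mem_normal N assms(3) by blast
qed

lemma subgroup_nat_pow_closed:
  assumes "subgroup K G" "x \<in> K" shows "x [^] (n::nat) \<in> K"
  using assms by (induction n) (auto simp: subgroup.one_closed intro: subgroup.m_closed)

lemma prime_subgroup_eq_powers:
  assumes K: "subgroup K G" "card K = p" "prime p" and x: "x \<in> K" "x \<noteq> \<one>"
  shows "ord x = p" "K = (\<lambda>i. x [^] i) ` {..<p}"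
proof -
  have fin: "finite K" using K(2,3) by (metis card.infinite not_prime_0)
  have xG: "x \<in> carrier G" using K(1) x(1) by (rule subgroup.mem_carrier)
  interpret KK: group "G\<lparr>carrier := K\<rparr>" using K(1) by (rule subgroup_imp_group)
  have "x [^] p = \<one>"
    using KK.pow_order_eq_1[of x] x(1) K(2) by (simp add: order_def flip: nat_pow_consistent)
  then have "ord x dvd p" using xG by (simp add: pow_eq_id)
  moreover have "ord x \<noteq> 1" using x(2) xG ord_eq_1 by simp
  ultimately show o: "ord x = p" using K(3) by (metis prime_nat_iff)
  have "{..<p} = {0..ord x - 1}" using o prime_gt_0_nat[OF K(3)] by auto
  then have "card ((\<lambda>i. x [^] i) ` {..<p}) = p"
    using card_image[OF ord_inj[OF xG]] o prime_gt_0_nat[OF K(3)] by simp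
  moreover have "(\<lambda>i. x [^] i) ` {..<p} \<subseteq> K"
    using subgroup_nat_pow_closed[OF K(1) x(1)] by blast
  ultimately show "K = (\<lambda>i. x [^] i) ` {..<p}"
    using fin K(2) card_subset_eq by metis
qed

lemma prime_subgroups_meet:
  assumes "subgroup K G" "card K = p" "subgroup L G" "card L = p" "prime p" "x \<in> K" "x \<in> L" "x \<noteq> \<one>"
  shows "K = L"
  using prime_subgroup_eq_powers(2)[OF assms(1,2,5,6,8)] prime_subgroup_eq_powers(2)[OF assms(3,4,5,7,8)]
  by (rule trans[OF _ sym])

text \<open>If \<open>k\<close> inverts \<open>m\<close> modulo the order of \<open>x\<close>, then
  \<open>x\<close> is the \<open>k\<close>-th power of \<open>x [^] m\<close>. Combined with the
  index argument, this puts elements of order prime to the index into the subgroup.\<close>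

lemma mem_subgroup_of_coprime_pow:
  assumes "subgroup K G" "x \<in> carrier G" "coprime (ord x) m" "x [^] (m::nat) \<in> K"
  shows "x \<in> K"
proof -
  obtain k where k: "[m * k = 1] (mod ord x)"
    using assms(3) by (metis One_nat_def cong_solve_coprime_nat coprime_commute)
  have "(x [^] m) [^] k = x"
  proof -
    have "x [^] int (m * k) = x [^] int 1"
      using int_pow_eq[OF assms(2)] k by (metis cong_iff_dvd_diff cong_int_iff cong_sym)
    then show ?thesis using assms(2) by (simp add: int_pow_int nat_pow_pow flip: of_nat_mult)
  qed
  moreover have "(x [^] m) [^] k \<in> K"
    using assms(1,4) by (rule subgroup_nat_pow_closed)
  ultimately show ?thesis by simp
qed

end

subsection \<open>Subgroups of order 11\<close>

text \<open>The facts extracted by \<open>order_of_Exp_rho\<close>; the order 330 is excluded only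
  in \<open>card_set_normalizer_syl11\<close>.\<close>

locale exponent_pattern = group G for G :: "('a, 'b) monoid_scheme" (structure) +
  assumes fin: "finite (carrier G)"
    and order: "order G \<in> {330, 660}"
    and exponent_5: "ord_exponent 5 G = 264"
    and exponent_11: "ord_exponent 11 G = 120"
begin

definition syl11 :: "'a set set" where
  "syl11 = {K. subgroup K G \<and> card K = 11}"

definition ord11 :: "'a set" where
  "ord11 = {g \<in> carrier G. 11 dvd ord g}"

lemma prime_11: "prime (11::nat)" by simp

lemma not_121_dvd: "\<not> 11 ^ 2 dvd order G"
  using order by auto

lemma syl11_subset: "K \<in> syl11 \<Longrightarrow> K \<subseteq> carrier G"
  by (auto simp: syl11_def subgroup.subset)

lemma syl11_one: "K \<in> syl11 \<Longrightarrow> \<one> \<in> K"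
  by (auto simp: syl11_def subgroup.one_closed)

lemma syl11_finite: "K \<in> syl11 \<Longrightarrow> finite K"
  using syl11_subset fin finite_subset by blast

lemma syl11_powers:
  assumes "K \<in> syl11" "x \<in> K" "x \<noteq> \<one>"
  shows "ord x = 11" "K = (\<lambda>i. x [^] i) ` {..<11::nat}"
  using prime_subgroup_eq_powers[of K 11 x] assms by (auto simp: syl11_def)

lemma syl11_meet:
  assumes "K \<in> syl11" "L \<in> syl11" "x \<in> K" "x \<in> L" "x \<noteq> \<one>"
  shows "K = L"
  using prime_subgroups_meet[of K 11 L x] assms by (auto simp: syl11_def)

lemma syl11_conj: "g \<in> carrier G \<Longrightarrow> K \<in> syl11 \<Longrightarrow> conj_set G g K \<in> syl11"
  using subgroup_conj_set[of g K] card_conj_set[of g K] syl11_subset[of K] by (auto simp: syl11_def)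

lemma finite_syl11: "finite syl11"
  using syl11_subset fin by (intro finite_subset[of syl11 "Pow (carrier G)"]) auto

lemma exists_nontrivial:
  assumes "K \<in> syl11" obtains x where "x \<in> K" "x \<noteq> \<one>"
proof -
  have "card K = 11" using assms by (simp add: syl11_def)
  then have "\<not> K \<subseteq> {\<one>}" using card_mono[of "{\<one>}" K] by auto
  then show thesis using that by blast
qed

text \<open>As 121 does not divide the order, every element contributes 0 or 1 to e_11.\<close>

lemma card_ord11: "card ord11 = 120"
proof -
  have "multiplicity 11 (ord g) = (if g \<in> ord11 then 1 else 0)" if g: "g \<in> carrier G" for g
  proof (cases "11 dvd ord g")
    case True
    have "\<not> 11 ^ 2 dvd ord g"
      using not_121_dvd ord_dvd_group_order[OF g] dvd_trans by blast
    then have "multiplicity 11 (ord g) = 1"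
      using True by (intro multiplicity_eqI) (simp_all add: power2_eq_square)
    then show ?thesis using True g by (simp add: ord11_def)
  next
    case False
    then show ?thesis by (simp add: ord11_def not_dvd_imp_multiplicity_0)
  qed
  then have "ord_exponent 11 G = (\<Sum>g\<in>carrier G. if g \<in> ord11 then 1 else 0)"
    unfolding ord_exponent_def by (intro sum.cong) auto
  also have "\<dots> = card (carrier G \<inter> ord11)"
    using fin by (simp add: sum.If_cases)
  also have "carrier G \<inter> ord11 = ord11" by (auto simp: ord11_def)
  finally show ?thesis using exponent_11 by simp
qed

lemma card_le_exponent_5:
  assumes "A \<subseteq> carrier G" "\<And>g. g \<in> A \<Longrightarrow> 5 dvd ord g"
  shows "card A \<le> 264"
proof -
  have "1 \<le> multiplicity 5 (ord g)" if "g \<in> A" for g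
  proof -
    have "ord g \<noteq> 0" using ord_ge_1[OF fin, of g] that assms(1) by auto
    then show ?thesis using assms(2)[OF that] by (intro multiplicity_geI) simp_all
  qed
  then have "(\<Sum>g\<in>A. 1) \<le> (\<Sum>g\<in>A. multiplicity 5 (ord g))" by (rule sum_mono)
  then have "card A \<le> (\<Sum>g\<in>A. multiplicity 5 (ord g))" by simp
  also have "\<dots> \<le> ord_exponent 5 G"
    unfolding ord_exponent_def by (rule sum_mono2) (use fin assms in auto)
  finally show ?thesis using exponent_5 by simp
qed

text \<open>The index of \<open>K\<close> in its normalizer is prime to 11, so an element of order
  11 normalizing \<open>K\<close> lies in \<open>K\<close>; two groups of order 11 sharing it
  coincide. Hence \<open>P\<close> acts freely on the other subgroups of order 11.\<close>

lemma normalizes_imp_eq: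
  assumes P: "P \<in> syl11" and K: "K \<in> syl11" and x: "x \<in> P" "x \<noteq> \<one>" "conj_set G x K = K"
  shows "P = K"
proof -
  let ?N = "set_normalizer G K"
  have xG: "x \<in> carrier G" using P x(1) syl11_subset by blast
  have KG: "subgroup K G" "card K = 11" using K by (auto simp: syl11_def)
  have N: "subgroup ?N G" using syl11_subset[OF K] by (rule subgroup_set_normalizer)
  have "card (rcosets\<^bsub>G\<lparr>carrier := ?N\<rparr>\<^esub> K) * card K = card ?N"
    using group.lagrange[OF subgroup_imp_group[OF N] subgroup_incl[OF KG(1) N subset_set_normalizer[OF KG(1)]]]
    by (simp add: order_def)
  then obtain m where m: "card ?N = 11 * m" using KG(2) by (metis mult.commute)
  have "card ?N dvd order G" using lagrange[OF N] by (metis dvd_triv_right)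
  have "\<not> 11 dvd m"
  proof
    assume "11 dvd m"
    then have "11 ^ 2 dvd card ?N" using m by (simp add: power2_eq_square)
    then show False using \<open>card ?N dvd order G\<close> not_121_dvd dvd_trans by blast
  qed
  then have "coprime (ord x) m"
    using syl11_powers(1)[OF P x(1,2)] prime_imp_coprime[OF prime_11] by simp
  moreover have "x [^] m \<in> K"
    using pow_index_mem_set_normalizer[OF KG(1) fin, of x] xG x(3) m KG(2) by (simp add: set_normalizer_def)
  ultimately have "x \<in> K" using mem_subgroup_of_coprime_pow[OF KG(1) xG] by blast
  then show ?thesis using syl11_meet[OF P K] x by blast
qed

lemma mem_ord11: "K \<in> syl11 \<Longrightarrow> x \<in> K \<Longrightarrow> x \<noteq> \<one> \<Longrightarrow> x \<in> ord11"
  using syl11_powers(1) syl11_subset by (fastforce simp: ord11_def)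

text \<open>Two counts meet. The 11 conjugates of \<open>K\<close> under \<open>P\<close> are
  distinct and differ from \<open>P\<close>, giving at least 12 subgroups; each subgroup has 10
  nontrivial elements of its own among the 120 of \<open>ord11\<close>, giving at most 12. Equality
  forces both descriptions.\<close>

lemma syl11_structure:
  assumes P: "P \<in> syl11" and K: "K \<in> syl11" "K \<noteq> P"
  shows "syl11 = insert P ((\<lambda>x. conj_set G x K) ` P)" "inj_on (\<lambda>x. conj_set G x K) P"
    "ord11 = (\<Union>L\<in>syl11. L - {\<one>})" "card syl11 = 12"
proof -
  have PG: "subgroup P G" "card P = 11" using P by (auto simp: syl11_def)
  have KG: "K \<subseteq> carrier G" using K(1) by (rule syl11_subset)
  show inj: "inj_on (\<lambda>x. conj_set G x K) P"
  proof (rule inj_onI)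
    fix x y assume xy: "x \<in> P" "y \<in> P" "conj_set G x K = conj_set G y K"
    have G: "x \<in> carrier G" "y \<in> carrier G" using xy syl11_subset[OF P] by auto
    have "conj_set G (inv y \<otimes> x) K = K"
      using G KG xy(3) conj_set_inv(1)[of y K] by (simp add: conj_set_mult)
    moreover have "inv y \<otimes> x \<in> P"
      using PG(1) xy by (intro subgroup.m_closed subgroup.m_inv_closed) auto
    ultimately have "inv y \<otimes> x = \<one>" using normalizes_imp_eq[OF P K(1)] K(2) by blast
    then show "x = y" using G by (metis inv_closed inv_equality inv_inv)
  qed
  let ?S = "insert P ((\<lambda>x. conj_set G x K) ` P)"
  have "P \<notin> (\<lambda>x. conj_set G x K) ` P"
  proof
    assume "P \<in> (\<lambda>x. conj_set G x K) ` P"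
    then obtain x where x: "x \<in> P" "conj_set G x K = P" by auto
    have xG: "x \<in> carrier G" using x(1) syl11_subset[OF P] by auto
    have "inv x \<in> set_normalizer G P"
      using subset_set_normalizer[OF PG(1)] subgroup.m_inv_closed[OF PG(1) x(1)] by blast
    then have "conj_set G (inv x) P = P" by (simp add: set_normalizer_def)
    then show False using conj_set_inv(1)[OF xG KG] x(2) K(2) by simp
  qed
  then have card12: "card ?S = 12"
    using syl11_finite[OF P] card_image[OF inj] PG(2) by simp
  have sub: "?S \<subseteq> syl11" using P K(1) syl11_conj syl11_subset[OF P] by auto
  have "card (\<Union>L\<in>syl11. L - {\<one>}) = (\<Sum>L\<in>syl11. card (L - {\<one>}))"
    using finite_syl11 syl11_finite syl11_meet by (intro card_UN_disjoint) auto
  also have "\<dots> = (\<Sum>L\<in>syl11. 10)"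
  proof (rule sum.cong)
    fix L assume L: "L \<in> syl11"
    then show "card (L - {\<one>}) = 10"
      using syl11_one[OF L] by (simp add: syl11_def)
  qed simp
  finally have cardU: "card (\<Union>L\<in>syl11. L - {\<one>}) = 10 * card syl11" by simp
  have finO: "finite ord11" using fin by (simp add: ord11_def)
  have subU: "(\<Union>L\<in>syl11. L - {\<one>}) \<subseteq> ord11" using mem_ord11 by blast
  have "10 * card syl11 \<le> 120"
    using card_mono[OF finO subU] cardU card_ord11 by simp
  moreover have "12 \<le> card syl11"
    using card_mono[OF finite_syl11 sub] card12 by simp
  ultimately show c: "card syl11 = 12" by simp
  show "syl11 = ?S" using card_subset_eq[OF finite_syl11 sub] c card12 by simp
  show "ord11 = (\<Union>L\<in>syl11. L - {\<one>})"
    using card_subset_eq[OF finO subU] cardU c card_ord11 by simp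
qed

lemma exists_syl11: "\<exists>P. P \<in> syl11"
proof -
  have "order G = 11 ^ 1 * (order G div 11)" using order by auto
  then show ?thesis
    using sylow_thm[OF prime_11 is_group _ fin, of 1] by (auto simp: syl11_def)
qed

text \<open>A normal subgroup of order 11 would have a centralizer of index 5, all of whose 528 outside
  elements have order divisible by 5.\<close>

lemma exists_two_syl11:
  assumes P: "P \<in> syl11"
  obtains K where "K \<in> syl11" "K \<noteq> P"
proof (rule ccontr)
  assume "\<not> thesis"
  then have only: "\<And>K. K \<in> syl11 \<Longrightarrow> K = P" using that by blast
  have PG: "subgroup P G" "card P = 11" using P by (auto simp: syl11_def)
  obtain p where p: "p \<in> P" "p \<noteq> \<one>" using exists_nontrivial[OF P] by blast
  have pG: "p \<in> carrier G" using p(1) syl11_subset[OF P] by blast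
  have pow: "P = (\<lambda>i. p [^] i) ` {..<11::nat}" using syl11_powers(2)[OF P p] .
  define C where "C = centralizer G p"
  have C: "subgroup C G" unfolding C_def using pG by (rule centralizer_subgroup)
  have PC: "x \<otimes> y = y \<otimes> x" if x: "x \<in> P" and y: "y \<in> C" for x y
  proof -
    obtain i :: nat where "x = p [^] i" using x pow by blast
    moreover have "p \<otimes> y = y \<otimes> p" using y by (simp add: C_def centralizer_def)
    ultimately show ?thesis using y pG by (simp add: C_def centralizer_def group_commutes_pow)
  qed
  have cyc: "generate G {x} \<in> syl11" if "x \<in> carrier G" "ord x = 11" for x
    using that generate_is_subgroup[of "{x}"] generate_pow_card[of x] by (simp add: syl11_def)
  have ord11_P: "x \<in> P" if "x \<in> carrier G" "ord x = 11" for x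
    using only[OF cyc[OF that]] generate.incl[of x "{x}" G] by simp
  have ord11_C: "ord11 \<subseteq> C"
  proof
    fix g assume "g \<in> ord11"
    then have g: "g \<in> carrier G" "11 dvd ord g" by (auto simp: ord11_def)
    define k where "k = ord g div 11"
    have k: "ord g = 11 * k" using g(2) by (simp add: k_def)
    have "ord g \<noteq> 0" using ord_ge_1[OF fin g(1)] by simp
    then have "ord (g [^] k) = 11" using ord_pow[OF g(1), of k] k by simp
    then have "g [^] k \<in> P" "g [^] k \<noteq> \<one>" using ord11_P[of "g [^] k"] g(1) by auto
    then have "P = (\<lambda>i. (g [^] k) [^] i) ` {..<11::nat}" using syl11_powers(2)[OF P] by blast
    then obtain i :: nat where "p = (g [^] k) [^] i" using p(1) by blast
    then have "p = g [^] (k * i)" using g(1) by (simp add: nat_pow_pow)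
    then show "g \<in> C" using g(1) by (simp add: C_def centralizer_def group_commutes_pow)
  qed
  have Pr: "r_elements 11 G = P"
  proof (intro equalityI subsetI)
    fix x assume "x \<in> r_elements 11 G"
    then obtain k where x: "x \<in> carrier G" "x [^] (11 ^ k :: nat) = \<one>" by (auto simp: r_elements_def)
    show "x \<in> P"
    proof (cases "x = \<one>")
      case False
      have "ord x dvd 11 ^ k" using x by (simp add: pow_eq_id)
      then obtain j where j: "ord x = 11 ^ j" using divides_primepow_nat[OF prime_11] by blast
      have "j \<noteq> 0" using False x(1) j ord_eq_1[of x] by (intro notI) simp
      moreover have "\<not> 2 \<le> j"
      proof
        assume "2 \<le> j"
        then have "11 ^ 2 dvd ord x" unfolding j by (rule le_imp_power_dvd)
        then show False using not_121_dvd ord_dvd_group_order[OF x(1)] dvd_trans by blast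
      qed
      ultimately have "ord x = 11" using j by (cases j) (auto simp: numeral_2_eq_2)
      then show ?thesis using ord11_P x(1) by blast
    qed (use syl11_one[OF P] in simp)
  next
    fix x assume x: "x \<in> P"
    have xG: "x \<in> carrier G" using x syl11_subset[OF P] by blast
    obtain i :: nat where i: "x = p [^] i" using x pow by blast
    have "x [^] (11::nat) = \<one>"
      using i pG syl11_powers(1)[OF P p] by (simp add: nat_pow_pow pow_eq_id)
    then show "x \<in> r_elements 11 G" using xG by (auto simp: r_elements_def intro!: exI[of _ 1])
  qed
  have r'_eq: "r'_elements 11 G = carrier G - ord11"
    using prime_imp_coprime[OF prime_11] by (auto simp: r'_elements_def ord11_def dest: coprime_common_divisor)
  have inter: "card (P \<inter> centralizer G y) = (if y \<in> C then 11 else 1)" if y: "y \<in> carrier G" for y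
  proof (cases "y \<in> C")
    case True
    then have "P \<inter> centralizer G y = P"
      using PC syl11_subset[OF P] by (auto simp: centralizer_def)
    then show ?thesis using True PG(2) by simp
  next
    case False
    have "x = \<one>" if x: "x \<in> P" "x \<in> centralizer G y" for x
    proof (rule ccontr)
      assume "x \<noteq> \<one>"
      then obtain i :: nat where "p = x [^] i" using syl11_powers(2)[OF P x(1)] p(1) by blast
      then show False
        using x False y by (simp add: C_def centralizer_def group_commutes_pow)
    qed
    then have "P \<inter> centralizer G y \<subseteq> {\<one>}" by blast
    moreover have "\<one> \<in> P \<inter> centralizer G y"
      using syl11_one[OF P] y by (simp add: centralizer_def)
    ultimately have "P \<inter> centralizer G y = {\<one>}" by blast
    then show ?thesis using False by simp
  qed
  let ?R = "carrier G - ord11"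
  have finR: "finite ?R" using fin by simp
  \<comment> \<open>With a and b the sizes of \<open>?R \<inter> C\<close> and
    \<open>?R - C\<close>, this sum gives |G| = 11 a + b, while removing the 120 elements of
    \<open>ord11\<close> gives |G| = a + b + 120. Hence a = 12 and |C| = 132, which does not divide
    330.\<close>
  have "order G = (\<Sum>y\<in>?R. card (P \<inter> centralizer G y))"
    using order_eq_sum_centralizers[OF fin prime_11] unfolding Pr r'_eq .
  also have "\<dots> = (\<Sum>y\<in>?R. if y \<in> C then 11 else 1)"
    by (rule sum.cong) (simp_all add: inter)
  also have "\<dots> = 11 * card (?R \<inter> C) + card (?R - C)"
    using finR by (simp add: sum.If_cases Diff_eq)
  finally have n: "order G = 11 * card (?R \<inter> C) + card (?R - C)" .
  have "card ?R = card (?R \<inter> C) + card (?R - C)" using finR by (rule card_Int_Diff)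
  moreover have "ord11 \<subseteq> carrier G" by (auto simp: ord11_def)
  then have "card ?R + 120 = order G"
    using card_Int_Diff[OF fin, of ord11] card_ord11 by (simp add: Int_absorb1 order_def)
  ultimately have a: "card (?R \<inter> C) = 12" using n by simp
  have "C = ord11 \<union> (?R \<inter> C)" using ord11_C subgroup.subset[OF C] by blast
  moreover have "ord11 \<inter> (?R \<inter> C) = {}" by blast
  moreover have "finite ord11" using fin by (simp add: ord11_def)
  ultimately have cC: "card C = 132" using card_Un_disjoint[of ord11 "?R \<inter> C"] finR a card_ord11 by simp
  have "card C dvd order G" using lagrange[OF C] by (metis dvd_triv_right)
  then have n660: "order G = 660" using order cC by auto
  \<comment> \<open>\<open>P\<close> is carried to itself by conjugation, and \<open>C\<close>
    centralizes all of \<open>P\<close>, in particular the conjugate of \<open>p\<close>.\<close>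
  have "g \<otimes> c \<otimes> inv g \<in> C" if g: "g \<in> carrier G" and c: "c \<in> C" for g c
  proof -
    have cG: "c \<in> carrier G" using c subgroup.subset[OF C] by blast
    have "conj_set G (inv g) P = P" by (intro only syl11_conj) (simp_all add: g P)
    moreover have "inv g \<otimes> p \<otimes> inv (inv g) \<in> conj_set G (inv g) P"
      using p(1) unfolding conj_set_def by blast
    ultimately have q: "inv g \<otimes> p \<otimes> g \<in> P" using g by simp
    define q where "q = inv g \<otimes> p \<otimes> g"
    have qG: "q \<in> carrier G" using g pG by (simp add: q_def)
    have "q \<otimes> c = c \<otimes> q" unfolding q_def using PC[OF q c] .
    then have "(g \<otimes> q \<otimes> inv g) \<otimes> (g \<otimes> c \<otimes> inv g) = (g \<otimes> c \<otimes> inv g) \<otimes> (g \<otimes> q \<otimes> inv g)"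
      by (simp only: conj_mult[OF g qG cG] conj_mult[OF g cG qG])
    moreover have "g \<otimes> q \<otimes> inv g = p" unfolding q_def using g pG by (rule conj_inv_cancel(2))
    ultimately show ?thesis using g cG by (simp add: C_def centralizer_def)
  qed
  then have "C \<lhd> G" using C by (simp add: normal_inv_iff)
  then have normal: "C \<lhd> (G\<lparr>carrier := carrier G\<rparr>)" by simp
  have "5 dvd ord g" if g: "g \<in> carrier G - C" for g
  proof (rule ccontr)
    assume "\<not> 5 dvd ord g"
    then have "coprime (ord g) 5" using prime_imp_coprime[of 5 "ord g"] by (simp add: coprime_commute)
    moreover have "g [^] (5::nat) \<in> C"
      using pow_index_mem_normal[OF normal subgroup_self fin, of g] g cC n660 by (simp add: order_def)
    ultimately show False using mem_subgroup_of_coprime_pow[OF C, of g 5] g by blast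
  qed
  then have "card (carrier G - C) \<le> 264" by (intro card_le_exponent_5) auto
  moreover have "card (carrier G - C) = 528"
    using subgroup.subset[OF C] fin cC n660 by (simp add: card_Diff_subset finite_subset order_def)
  ultimately show False by simp
qed

end

section \<open>Double transitivity and two-point stabilizers\<close>

context exponent_pattern
begin

lemma syl11_move:
  assumes "P \<in> syl11" "K \<in> syl11" "L \<in> syl11" "K \<noteq> P" "L \<noteq> P"
  obtains x where "x \<in> P" "conj_set G x K = L"
  using syl11_structure(1)[OF assms(1,2,4)] assms(3,5) by blast

lemma exists_third_syl11:
  obtains L where "L \<in> syl11" "L \<noteq> P" "L \<noteq> K"
proof -
  obtain P' where P': "P' \<in> syl11" using exists_syl11 by blast
  obtain K' where "K' \<in> syl11" "K' \<noteq> P'" using exists_two_syl11[OF P'] by blast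
  then have "card syl11 = 12" using syl11_structure(4)[OF P'] by blast
  moreover have "card {P, K} \<le> 2" by (simp add: card_insert_if)
  ultimately have "\<not> syl11 \<subseteq> {P, K}" using card_mono[of "{P, K}" syl11] by auto
  then show thesis using that by blast
qed

lemma syl11_transitive:
  assumes "P \<in> syl11" "K \<in> syl11"
  obtains g where "g \<in> carrier G" "conj_set G g P = K"
proof -
  obtain L where L: "L \<in> syl11" "L \<noteq> P" "L \<noteq> K" using exists_third_syl11 by blast
  obtain x where "x \<in> L" "conj_set G x P = K"
    using syl11_move[OF L(1) assms(1,2)] L(2,3) by metis
  then show thesis using that L(1) syl11_subset by blast
qed

text \<open>Take \<open>x\<close> carrying \<open>P\<close> to \<open>Q\<close>. The image of
  \<open>Q\<close> under \<open>x\<close> is not \<open>Q\<close>, so some \<open>q\<close> in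
  \<open>Q\<close> moves it to \<open>P\<close>; as \<open>q\<close> normalizes \<open>Q\<close>,
  the product \<open>q \<otimes> x\<close> exchanges the two.\<close>

lemma syl11_swap:
  assumes P: "P \<in> syl11" and Q: "Q \<in> syl11" and "P \<noteq> Q"
  obtains t where "t \<in> carrier G" "conj_set G t P = Q" "conj_set G t Q = P"
proof -
  obtain x where x: "x \<in> carrier G" "conj_set G x P = Q" using syl11_transitive[OF P Q] by blast
  have R: "conj_set G x Q \<in> syl11" using syl11_conj[OF x(1) Q] .
  have "conj_set G x Q \<noteq> Q"
    using conj_set_inv(1)[OF x(1) syl11_subset[OF P]] conj_set_inv(1)[OF x(1) syl11_subset[OF Q]] x(2) \<open>P \<noteq> Q\<close>
    by metis
  then obtain q where q: "q \<in> Q" "conj_set G q (conj_set G x Q) = P"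
    using syl11_move[OF Q R P] \<open>P \<noteq> Q\<close> by metis
  have qG: "q \<in> carrier G" using q(1) syl11_subset[OF Q] by blast
  have "q \<in> set_normalizer G Q" using q(1) Q subset_set_normalizer by (auto simp: syl11_def)
  then have "conj_set G q Q = Q" by (simp add: set_normalizer_def)
  then show thesis
    using that[of "q \<otimes> x"] x q qG conj_set_mult[OF qG x(1) syl11_subset[OF P]]
      conj_set_mult[OF qG x(1) syl11_subset[OF Q]] by simp
qed

text \<open>The elements carrying \<open>P\<close> to a given conjugate form a coset of the
  normalizer, so the order is 12 times that of the normalizer; 330 is not a multiple of 12.\<close>

lemma card_set_normalizer_syl11:
  assumes P: "P \<in> syl11"
  shows "card (set_normalizer G P) = 55" "order G = 660"
proof -
  let ?N = "set_normalizer G P"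
  have PG: "P \<subseteq> carrier G" using P by (rule syl11_subset)
  have fib: "card {g \<in> carrier G. conj_set G g P = K} = card ?N" if K: "K \<in> syl11" for K
  proof -
    obtain t where t: "t \<in> carrier G" "conj_set G t P = K" using syl11_transitive[OF P K] by blast
    have "bij_betw (\<lambda>n. t \<otimes> n) ?N {g \<in> carrier G. conj_set G g P = K}"
    proof (rule bij_betwI[where g = "\<lambda>g. inv t \<otimes> g"])
      show "(\<lambda>g. inv t \<otimes> g) \<in> {g \<in> carrier G. conj_set G g P = K} \<rightarrow> ?N"
        using t PG conj_set_inv(1)[OF t(1) PG] by (auto simp: set_normalizer_def conj_set_mult)
    qed (use t PG in \<open>auto simp: set_normalizer_def conj_set_mult m_assoc[symmetric]\<close>)
    then show ?thesis by (metis bij_betw_same_card)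
  qed
  have "order G = (\<Sum>g\<in>carrier G. 1)" by (simp add: order_def)
  also have "\<dots> = (\<Sum>K\<in>syl11. \<Sum>g | g \<in> carrier G \<and> conj_set G g P = K. 1)"
    using fin finite_syl11 syl11_conj P by (intro sum.group[symmetric]) auto
  also have "\<dots> = (\<Sum>K\<in>syl11. card ?N)"
    by (rule sum.cong) (simp_all add: fib)
  also have "\<dots> = 12 * card ?N"
  proof -
    obtain K where "K \<in> syl11" "K \<noteq> P" using exists_two_syl11[OF P] by blast
    then show ?thesis using syl11_structure(4)[OF P] by simp
  qed
  finally have n: "order G = 12 * card ?N" .
  then have "order G \<noteq> 330" by presburger
  then show "order G = 660" using order by simp
  then show "card ?N = 55" using n by simp
qed

text \<open>\<open>P\<close> acts regularly on the other 11 subgroups: exactly one \<open>x\<close>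
  in \<open>P\<close> moves \<open>Q\<close> where a given element of the normalizer moves it, and
  the remaining factor fixes both \<open>P\<close> and \<open>Q\<close>.\<close>

lemma set_normalizer_factor:
  assumes P: "P \<in> syl11" and Q: "Q \<in> syl11" and "P \<noteq> Q"
  shows "bij_betw (\<lambda>(x, h). x \<otimes> h) (P \<times> (set_normalizer G P \<inter> set_normalizer G Q)) (set_normalizer G P)"
proof -
  let ?H = "set_normalizer G P \<inter> set_normalizer G Q"
  have PG: "subgroup P G" using P by (simp add: syl11_def)
  have NP: "subgroup (set_normalizer G P) G" and NQ: "subgroup (set_normalizer G Q) G"
    using syl11_subset P Q subgroup_set_normalizer by blast+
  have PN: "P \<subseteq> set_normalizer G P" using PG by (rule subset_set_normalizer)
  have triv: "x = \<one>" if x: "x \<in> P" "x \<in> set_normalizer G Q" for x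
    using normalizes_imp_eq[OF P Q x(1)] x(2) \<open>P \<noteq> Q\<close> unfolding set_normalizer_def by blast
  show ?thesis
  proof (rule bij_betw_imageI)
    show "inj_on (\<lambda>(x, h). x \<otimes> h) (P \<times> ?H)"
    proof (rule inj_onI, clarify)
      fix x h y k
      assume x: "x \<in> P" and y: "y \<in> P" and h: "h \<in> set_normalizer G P" "h \<in> set_normalizer G Q"
        and k: "k \<in> set_normalizer G P" "k \<in> set_normalizer G Q" and eq: "x \<otimes> h = y \<otimes> k"
      have G: "x \<in> carrier G" "y \<in> carrier G" "h \<in> carrier G" "k \<in> carrier G"
        using x y h k subgroup.mem_carrier[OF PG] subgroup.mem_carrier[OF NP] by blast+
      have "inv y \<otimes> x = inv y \<otimes> (x \<otimes> h) \<otimes> inv h" using G by (simp add: m_assoc)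
      also have "\<dots> = k \<otimes> inv h" unfolding eq using G by (simp add: m_assoc[symmetric])
      finally have 1: "inv y \<otimes> x = k \<otimes> inv h" .
      have "k \<otimes> inv h \<in> set_normalizer G Q"
        using h k NQ by (intro subgroup.m_closed subgroup.m_inv_closed)
      moreover have "inv y \<otimes> x \<in> P"
        using x y PG by (intro subgroup.m_closed subgroup.m_inv_closed)
      ultimately have "inv y \<otimes> x = \<one>" using triv unfolding 1 by blast
      then have "x = y" using G by (metis inv_closed inv_equality inv_inv)
      then show "x = y \<and> h = k" using eq G by simp
    qed
    show "(\<lambda>(x, h). x \<otimes> h) ` (P \<times> ?H) = set_normalizer G P"
    proof (intro equalityI subsetI)
      fix g assume "g \<in> (\<lambda>(x, h). x \<otimes> h) ` (P \<times> ?H)"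
      then show "g \<in> set_normalizer G P" using PN NP by (auto intro: subgroup.m_closed)
    next
      fix g assume g: "g \<in> set_normalizer G P"
      have gG: "g \<in> carrier G" using g subgroup.mem_carrier[OF NP] by blast
      have gP: "conj_set G g P = P" using g by (simp add: set_normalizer_def)
      have "conj_set G g Q \<noteq> P"
        using conj_set_inv(1)[OF gG syl11_subset[OF P]] conj_set_inv(1)[OF gG syl11_subset[OF Q]] gP \<open>P \<noteq> Q\<close>
        by metis
      then obtain x where x: "x \<in> P" "conj_set G x Q = conj_set G g Q"
        using syl11_move[OF P Q syl11_conj[OF gG Q]] \<open>P \<noteq> Q\<close> by metis
      have xG: "x \<in> carrier G" using x(1) subgroup.mem_carrier[OF PG] by blast
      have "conj_set G (inv x \<otimes> g) Q = Q"
        using x(2) xG gG syl11_subset[OF Q] conj_set_inv(1)[of x Q] by (simp add: conj_set_mult)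
      then have "inv x \<otimes> g \<in> set_normalizer G Q" using xG gG by (simp add: set_normalizer_def)
      moreover have "inv x \<otimes> g \<in> set_normalizer G P"
        using x(1) g PN NP by (intro subgroup.m_closed subgroup.m_inv_closed) auto
      moreover have "x \<otimes> (inv x \<otimes> g) = g" using xG gG by (simp add: m_assoc[symmetric])
      ultimately show "g \<in> (\<lambda>(x, h). x \<otimes> h) ` (P \<times> ?H)"
        using x(1) by (intro image_eqI[of _ _ "(x, inv x \<otimes> g)"]) auto
    qed
  qed
qed

lemma two_point_stabilizer:
  assumes P: "P \<in> syl11" and Q: "Q \<in> syl11" and "P \<noteq> Q"
  shows "subgroup (set_normalizer G P \<inter> set_normalizer G Q) G"
    "card (set_normalizer G P \<inter> set_normalizer G Q) = 5"
proof -
  show "subgroup (set_normalizer G P \<inter> set_normalizer G Q) G"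
    using subgroups_Inter_pair[OF subgroup_set_normalizer[OF syl11_subset[OF P]]
        subgroup_set_normalizer[OF syl11_subset[OF Q]]] .
  have "card P * card (set_normalizer G P \<inter> set_normalizer G Q) = 55"
    using bij_betw_same_card[OF set_normalizer_factor[OF assms]] card_set_normalizer_syl11(1)[OF P]
    by (simp add: card_cartesian_product)
  then show "card (set_normalizer G P \<inter> set_normalizer G Q) = 5"
    using P by (simp add: syl11_def)
qed

text \<open>Elements of the normalizer of \<open>P\<close> with order divisible by 11 lie in
  \<open>P\<close>. If \<open>c\<close> is not such an element, then \<open>p \<otimes> c\<close>
  is, because \<open>p\<close> and \<open>c\<close> commute.\<close>

lemma centralizer_in_syl11:
  assumes P: "P \<in> syl11" and p: "p \<in> P" "p \<noteq> \<one>" and c: "c \<in> carrier G" "c \<otimes> p = p \<otimes> c"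
  shows "c \<in> P"
proof -
  have pG: "p \<in> carrier G" using p(1) syl11_subset[OF P] by blast
  have PG: "subgroup P G" using P by (simp add: syl11_def)
  have "c \<otimes> x \<otimes> inv c = x" if x: "x \<in> P" for x
  proof -
    obtain i :: nat where i: "x = p [^] i" using syl11_powers(2)[OF P p] x by blast
    have "p \<otimes> c = c \<otimes> p" using c(2) by (rule sym)
    then have "x \<otimes> c = c \<otimes> x" unfolding i using group_commutes_pow[of p c i] pG c(1) by blast
    then show ?thesis using c(1) pG i by (simp add: inv_solve_right')
  qed
  then have "conj_set G c P = P" unfolding conj_set_def by (metis (no_types, lifting) image_cong image_ident)
  then have cN: "c \<in> set_normalizer G P" using c(1) by (simp add: set_normalizer_def)
  have *: "g \<in> P" if g: "g \<in> set_normalizer G P" "11 dvd ord g" for g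
  proof -
    have gG: "g \<in> carrier G" using g(1) by (simp add: set_normalizer_def)
    have g1: "g \<noteq> \<one>" using g(2) by auto
    obtain K where K: "K \<in> syl11" "K \<noteq> P" using exists_two_syl11[OF P] by blast
    have "g \<in> ord11" using g(2) gG by (simp add: ord11_def)
    then obtain L where L: "L \<in> syl11" "g \<in> L" using syl11_structure(3)[OF P K] by blast
    have "L = P" using normalizes_imp_eq[OF L(1) P L(2) g1] g(1) by (simp add: set_normalizer_def)
    then show ?thesis using L(2) by simp
  qed
  show ?thesis
  proof (cases "11 dvd ord c")
    case True then show ?thesis using * cN by blast
  next
    case False
    have pN: "p \<in> set_normalizer G P" using subset_set_normalizer[OF PG] p(1) by blast
    have pcN: "p \<otimes> c \<in> set_normalizer G P"
      using subgroup.m_closed[OF subgroup_set_normalizer[OF syl11_subset[OF P]] pN cN] .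
    have "(p \<otimes> c) [^] (ord (p \<otimes> c) * ord c) = \<one>" using pG c(1) by (simp add: pow_eq_id)
    moreover have "(p \<otimes> c) [^] (ord (p \<otimes> c) * ord c) = p [^] (ord (p \<otimes> c) * ord c) \<otimes> c [^] (ord (p \<otimes> c) * ord c)"
      using pow_mult_distrib[OF c(2)[symmetric] pG c(1)] .
    moreover have "c [^] (ord (p \<otimes> c) * ord c) = \<one>" using c(1) by (simp add: pow_eq_id)
    ultimately have "p [^] (ord (p \<otimes> c) * ord c) = \<one>" using pG by simp
    then have "11 dvd ord (p \<otimes> c) * ord c" using pG syl11_powers(1)[OF P p] by (simp add: pow_eq_id)
    then have "11 dvd ord (p \<otimes> c)" using False prime_dvd_mult_nat[OF prime_11] by blast
    then have pcP: "p \<otimes> c \<in> P" using * pcN by blast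
    have "inv p \<otimes> (p \<otimes> c) = c" using pG c(1) by (simp add: m_assoc[symmetric])
    then show ?thesis using subgroup.m_closed[OF PG subgroup.m_inv_closed[OF PG p(1)] pcP] by simp
  qed
qed

lemma conj_pow_iterate:
  assumes "h \<in> carrier G" "p \<in> carrier G" "h \<otimes> p \<otimes> inv h = p [^] (k::nat)"
  shows "h [^] (i::nat) \<otimes> p \<otimes> inv (h [^] i) = p [^] (k ^ i)"
proof (induction i)
  case (Suc i)
  have "h [^] Suc i \<otimes> p \<otimes> inv (h [^] Suc i) = h [^] i \<otimes> (h \<otimes> p \<otimes> inv h) \<otimes> inv (h [^] i)"
    using assms(1,2) by (simp add: inv_mult_group m_assoc)
  also have "\<dots> = (h [^] i \<otimes> p \<otimes> inv (h [^] i)) [^] k"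
    using assms by (simp add: conj_pow)
  also have "\<dots> = p [^] (k ^ Suc i)"
    unfolding Suc using assms(2) by (simp add: nat_pow_pow mult.commute)
  finally show ?case .
qed (use assms in simp)

lemma pow_mod_ord: "x \<in> carrier G \<Longrightarrow> [i = j] (mod ord x) \<Longrightarrow> x [^] (i::nat) = x [^] j"
  using int_pow_eq[of x "int i" "int j"]
  by (metis cong_iff_dvd_diff cong_int_iff cong_sym int_pow_int)

text \<open>An element of order 5 in the stabilizer raises \<open>p\<close> to some power
  \<open>k\<close> with \<open>k ^ 5 = 1\<close> modulo 11. The value 1 is impossible: it would put
  the element into \<open>P\<close>, where only the identity normalizes \<open>Q\<close>. A power of
  the element then has multiplier 4.\<close>

lemma exists_torus_generator:
  assumes P: "P \<in> syl11" and Q: "Q \<in> syl11" and PQ: "P \<noteq> Q" and p: "p \<in> P" "p \<noteq> \<one>"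
  obtains h where "h \<in> set_normalizer G P \<inter> set_normalizer G Q" "ord h = 5"
    "h \<otimes> p \<otimes> inv h = p [^] (4::nat)"
    "set_normalizer G P \<inter> set_normalizer G Q = (\<lambda>i. h [^] i) ` {..<5::nat}"
proof -
  let ?H = "set_normalizer G P \<inter> set_normalizer G Q"
  note H = two_point_stabilizer[OF P Q PQ]
  have pG: "p \<in> carrier G" using p(1) syl11_subset[OF P] by blast
  have "finite ?H" using fin by (simp add: set_normalizer_def)
  then obtain h where h: "h \<in> ?H" "ord h = 5"
    using cauchy_subgroup[OF H(1), of 5] H(2) by auto
  have hG: "h \<in> carrier G" using h(1) by (simp add: set_normalizer_def)
  have "conj_set G h P = P" using h(1) by (simp add: set_normalizer_def)
  then have "h \<otimes> p \<otimes> inv h \<in> P" using p(1) unfolding conj_set_def by blast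
  then obtain k :: nat where k: "k < 11" "h \<otimes> p \<otimes> inv h = p [^] k"
    using syl11_powers(2)[OF P p] by blast
  have "p [^] (k ^ 5) = p [^] (1::nat)"
    using conj_pow_iterate[OF hG pG k(2), of 5] h(2) hG pG pow_ord_eq_1[of h] by simp
  then have "p [^] int (k ^ 5) = p [^] int 1" by (simp only: int_pow_int)
  then have "[k ^ 5 = 1] (mod 11)"
    using int_pow_eq[OF pG] syl11_powers(1)[OF P p] by (metis cong_iff_dvd_diff cong_int_iff cong_sym)
  then have k5: "k ^ 5 mod 11 = 1" by (simp add: cong_def)
  have "k \<noteq> 1"
  proof
    assume "k = 1"
    then have "h \<otimes> p \<otimes> inv h = p" using k(2) pG by simp
    then have "h \<otimes> p = p \<otimes> h" using hG pG by (simp add: inv_solve_right')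
    then have "h \<in> P" using centralizer_in_syl11[OF P p hG] by blast
    moreover have "h \<noteq> \<one>" using h(2) by auto
    ultimately show False
      using normalizes_imp_eq[OF P Q, of h] h(1) PQ by (simp add: set_normalizer_def)
  qed
  moreover have "k \<in> {0, 1, 2, 3, 4, 5, 6, 7, 8, 9, 10}" using k(1) by simp arith
  \<comment> \<open>The solutions of \<open>k ^ 5 = 1\<close> are the nonzero squares 1, 3, 4, 5, 9,
    a cyclic group of prime order, so each solution other than 1 has 4 among its powers.\<close>
  moreover have "\<forall>k\<in>{0, 1, 2, 3, 4, 5, 6, 7, 8, 9, 10}. k ^ 5 mod 11 = (1::nat) \<longrightarrow> k \<noteq> 1 \<longrightarrow>
      (\<exists>i\<in>{1, 2, 3, 4}. k ^ i mod 11 = 4)"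
    by simp
  ultimately obtain i where i: "i \<in> {1, 2, 3, 4}" "k ^ i mod 11 = 4"
    using k5 by blast
  have hi: "h [^] i \<in> ?H" using subgroup_nat_pow_closed[OF H(1) h(1)] .
  have "\<not> 5 dvd i" using i(1) by auto
  then have hi1: "h [^] i \<noteq> \<one>" using h(2) hG by (simp add: pow_eq_id)
  have "h [^] i \<otimes> p \<otimes> inv (h [^] i) = p [^] (k ^ i)" by (rule conj_pow_iterate[OF hG pG k(2)])
  also have "\<dots> = p [^] (4::nat)"
    by (rule pow_mod_ord[OF pG]) (use i(2) syl11_powers(1)[OF P p] in \<open>simp add: cong_def\<close>)
  finally show thesis
    using that[OF hi] prime_subgroup_eq_powers[OF H(1,2) _ hi hi1] by simp
qed

end

subsection \<open>The action on the projective line\<close>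

text \<open>A choice of coordinates: \<open>P\<close> plays infinity, \<open>Q\<close> zero,
  \<open>p\<close> the translation by 1 and \<open>h\<close> the multiplication by 4.\<close>

locale framed_pattern = exponent_pattern G for G :: "('a, 'b) monoid_scheme" (structure) +
  fixes P Q :: "'a set" and p h :: 'a
  assumes P: "P \<in> syl11" and Q: "Q \<in> syl11" and PQ: "P \<noteq> Q"
    and p: "p \<in> P" "p \<noteq> \<one>"
    and h: "h \<in> set_normalizer G P \<inter> set_normalizer G Q" "ord h = 5"
    and h_conj: "h \<otimes> p \<otimes> inv h = p [^] (4::nat)"
    and stab: "set_normalizer G P \<inter> set_normalizer G Q = (\<lambda>i. h [^] i) ` {..<5::nat}"
begin

text \<open>The points \<open>0, \<dots>, 10\<close> stand for the elements of the prime field and \<open>11\<close> for infinity.\<close>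

definition lab :: "nat \<Rightarrow> 'a set" where
  "lab i = (if i = 11 then P else conj_set G (p [^] i) Q)"

text \<open>The restriction to \<open>{..<12}\<close> makes the value extensional, as elements of
  \<open>BijGroup\<close> are.\<close>

definition perm :: "'a \<Rightarrow> nat \<Rightarrow> nat" where
  "perm g = (\<lambda>i\<in>{..<12}. inv_into {..<12} lab (conj_set G g (lab i)))"

lemma carr: "p \<in> carrier G" "h \<in> carrier G" "P \<subseteq> carrier G" "Q \<subseteq> carrier G"
  using p h P Q syl11_subset by (auto simp: set_normalizer_def)

lemma ord_p: "ord p = 11"
  using syl11_powers(1)[OF P p] .

lemma bij_lab: "bij_betw lab {..<12} syl11"
proof -
  have "{..<12::nat} = insert 11 {..<11}" by auto
  then have "lab ` {..<12} = insert P ((\<lambda>i. conj_set G (p [^] i) Q) ` {..<11::nat})"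
    by (auto simp: lab_def)
  also have "(\<lambda>i. conj_set G (p [^] i) Q) ` {..<11::nat} = (\<lambda>x. conj_set G x Q) ` P"
    unfolding syl11_powers(2)[OF P p] image_image ..
  also have "insert P \<dots> = syl11"
    using syl11_structure(1)[OF P Q] PQ by simp
  finally have img: "lab ` {..<12} = syl11" .
  moreover have "card syl11 = 12" using syl11_structure(4)[OF P Q] PQ by simp
  ultimately have "inj_on lab {..<12}" by (intro eq_card_imp_inj_on) simp_all
  then show ?thesis using img by (simp add: bij_betw_def)
qed

lemma lab_mem: "i < 12 \<Longrightarrow> lab i \<in> syl11"
  using bij_lab by (auto simp: bij_betw_def)

lemma lab_subset: "i < 12 \<Longrightarrow> lab i \<subseteq> carrier G"
  using lab_mem syl11_subset by blast

lemma lab_eq_iff: "i < 12 \<Longrightarrow> j < 12 \<Longrightarrow> lab i = lab j \<longleftrightarrow> i = j"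
  using bij_lab by (auto simp: bij_betw_def inj_on_def)

lemma perm_lt: "g \<in> carrier G \<Longrightarrow> i < 12 \<Longrightarrow> perm g i < 12"
  and lab_perm: "g \<in> carrier G \<Longrightarrow> i < 12 \<Longrightarrow> lab (perm g i) = conj_set G g (lab i)"
proof -
  assume "g \<in> carrier G" "i < 12"
  then have "conj_set G g (lab i) \<in> lab ` {..<12}"
    using syl11_conj lab_mem bij_lab by (simp add: bij_betw_def)
  then show "perm g i < 12" "lab (perm g i) = conj_set G g (lab i)"
    using \<open>i < 12\<close> inv_into_into[of _ lab "{..<12}"] f_inv_into_f[of _ lab "{..<12}"]
    by (auto simp: perm_def)
qed

lemma perm_eqI:
  assumes "g \<in> carrier G" "i < 12" "j < 12" "conj_set G g (lab i) = lab j"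
  shows "perm g i = j"
  using assms lab_perm perm_lt lab_eq_iff by metis

lemma perm_mult:
  assumes "g \<in> carrier G" "k \<in> carrier G" "i < 12"
  shows "perm (g \<otimes> k) i = perm g (perm k i)"
  using assms by (intro perm_eqI) (simp_all add: perm_lt lab_perm conj_set_mult lab_subset)

lemma perm_one: "i < 12 \<Longrightarrow> perm \<one> i = i"
  by (intro perm_eqI) (simp_all add: conj_set_one lab_subset)

lemma perm_inj:
  assumes "g \<in> carrier G" "i < 12" "j < 12" "perm g i = perm g j"
  shows "i = j"
proof -
  have "perm (inv g \<otimes> g) i = perm (inv g \<otimes> g) j"
    using assms by (simp only: perm_mult inv_closed)
  then show ?thesis using assms by (simp add: perm_one)
qed

lemma perm_hom: "perm \<in> hom G (BijGroup {..<12})"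
proof -
  have mem: "perm g \<in> Bij {..<12}" if g: "g \<in> carrier G" for g
  proof -
    have "inj_on (perm g) {..<12}" using perm_inj[OF g] by (auto intro: inj_onI)
    moreover have "perm g ` {..<12} \<subseteq> {..<12}" using perm_lt[OF g] by auto
    ultimately have "bij_betw (perm g) {..<12} {..<12}"
      by (simp add: bij_betw_def endo_inj_surj)
    then show ?thesis by (simp add: Bij_def perm_def)
  qed
  show ?thesis
  proof (rule homI)
    show "perm g \<in> carrier (BijGroup {..<12})" if "g \<in> carrier G" for g
      using mem[OF that] by (simp add: BijGroup_def)
  fix g k assume gk: "g \<in> carrier G" "k \<in> carrier G"
  have "perm (g \<otimes> k) = compose {..<12} (perm g) (perm k)"
  proof (rule extensionalityI)
    show "perm (g \<otimes> k) \<in> extensional {..<12}" by (simp add: perm_def)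
    show "perm (g \<otimes> k) i = compose {..<12} (perm g) (perm k) i" if "i \<in> {..<12}" for i
      using that perm_mult[OF gk] by (simp add: compose_def)
  qed (rule compose_extensional)
  then show "perm (g \<otimes> k) = perm g \<otimes>\<^bsub>BijGroup {..<12}\<^esub> perm k"
    using mem[OF gk(1)] mem[OF gk(2)] by (simp add: BijGroup_def)
  qed
qed

lemma lab_mod: "conj_set G (p [^] (i::nat)) Q = lab (i mod 11)"
proof -
  have "p [^] i = p [^] (i mod 11)" by (rule pow_mod_ord) (simp_all add: carr ord_p cong_def)
  moreover have "i mod 11 \<noteq> 11" using mod_less_divisor[of 11 i] by linarith
  ultimately show ?thesis by (simp add: lab_def)
qed

lemma mod_11_less: "(n::nat) mod 11 < 12"
  by (rule less_trans[OF mod_less_divisor]) simp_all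

lemma perm_p: "i < 12 \<Longrightarrow> perm p i = (if i < 11 then (i + 1) mod 11 else 11)"
proof (rule perm_eqI)
  assume i: "i < 12"
  show "(if i < 11 then (i + 1) mod 11 else 11) < 12"
    using mod_11_less[of "i + 1"] by simp
  show "conj_set G p (lab i) = lab (if i < 11 then (i + 1) mod 11 else 11)"
  proof (cases "i < 11")
    case True
    have "conj_set G p (lab i) = conj_set G (p \<otimes> p [^] i) Q"
      using True carr by (simp add: lab_def conj_set_mult)
    also have "p \<otimes> p [^] i = p [^] (i + 1)"
      using carr nat_pow_mult[of p 1 i] by (simp add: add.commute)
    also have "conj_set G \<dots> Q = lab ((i + 1) mod 11)" by (rule lab_mod)
    finally show ?thesis using True by simp
  next
    case False
    then have "i = 11" using i by simp
    moreover have "p \<in> set_normalizer G P" using p(1) subset_set_normalizer P by (auto simp: syl11_def)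
    ultimately show ?thesis by (simp add: lab_def set_normalizer_def)
  qed
qed (simp_all add: carr)

lemma h_pow_normalizes: "conj_set G (h [^] (k::nat)) P = P" "conj_set G (h [^] (k::nat)) Q = Q"
  using subgroup_nat_pow_closed[OF two_point_stabilizer(1)[OF P Q PQ] h(1), of k]
  by (simp_all add: set_normalizer_def)

lemma perm_h_pow: "i < 12 \<Longrightarrow> perm (h [^] (k::nat)) i = (if i < 11 then 4 ^ k * i mod 11 else 11)"
proof (rule perm_eqI)
  assume i: "i < 12"
  show "(if i < 11 then 4 ^ k * i mod 11 else 11) < 12"
    using mod_11_less[of "4 ^ k * i"] by simp
  show "conj_set G (h [^] k) (lab i) = lab (if i < 11 then 4 ^ k * i mod 11 else 11)"
  proof (cases "i < 11")
    case True
    have "h [^] k \<otimes> p [^] i \<otimes> inv (h [^] k) = (h [^] k \<otimes> p \<otimes> inv (h [^] k)) [^] i"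
      using carr by (simp add: conj_pow)
    also have "\<dots> = p [^] (4 ^ k * i)"
      using conj_pow_iterate[OF carr(2,1) h_conj] carr by (simp add: nat_pow_pow)
    finally have "h [^] k \<otimes> p [^] i = p [^] (4 ^ k * i) \<otimes> h [^] k"
      using carr by (simp add: inv_solve_right')
    moreover have "conj_set G (h [^] k) (lab i) = conj_set G (h [^] k \<otimes> p [^] i) Q"
      using True carr by (simp add: lab_def conj_set_mult)
    ultimately have "conj_set G (h [^] k) (lab i) = conj_set G (p [^] (4 ^ k * i)) Q"
      using carr by (simp add: conj_set_mult h_pow_normalizes)
    then show ?thesis using True lab_mod by simp
  next
    case False
    then have "i = 11" using i by simp
    then show ?thesis by (simp add: lab_def h_pow_normalizes)
  qed
qed (simp_all add: carr)

lemma lab_special: "lab 11 = P" "lab 0 = Q"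
  using carr by (simp_all add: lab_def conj_set_one)

text \<open>Fixing infinity and 0 leaves only powers of \<open>h\<close>, and \<open>h [^] k\<close>
  sends 1 to \<open>4 ^ k\<close>, where 4 has order 5 modulo 11. This gives faithfulness, and later
  turns a check at three points into a relation in \<open>G\<close>.\<close>

lemma perm_fixes_three:
  assumes g: "g \<in> carrier G" and fixed: "perm g 11 = 11" "perm g 0 = 0" "perm g 1 = 1"
  shows "g = \<one>"
proof -
  have "conj_set G g P = P" "conj_set G g Q = Q"
    using lab_perm[OF g, of 11] lab_perm[OF g, of 0] fixed by (simp_all add: lab_special)
  then have "g \<in> set_normalizer G P \<inter> set_normalizer G Q" using g by (simp add: set_normalizer_def)
  then obtain k :: nat where k: "k < 5" "g = h [^] k" unfolding stab by blast
  then have "4 ^ k mod 11 = (1::nat)" using fixed(3) perm_h_pow[of 1 k] by simp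
  moreover have "k = 0 \<or> k = 1 \<or> k = 2 \<or> k = 3 \<or> k = 4" using k(1) by arith
  ultimately have "k = 0" by auto
  then show ?thesis using k(2) by simp
qed

lemma perm_faithful: "inj_on perm (carrier G)"
proof (rule inj_onI)
  fix g k assume gk: "g \<in> carrier G" "k \<in> carrier G" "perm g = perm k"
  have "perm (inv k \<otimes> g) i = i" if "i < 12" for i
    using gk that perm_mult[of "inv k" g i] perm_mult[of "inv k" k i] by (simp add: perm_one)
  then have "inv k \<otimes> g = \<one>" using gk by (intro perm_fixes_three) simp_all
  then show "g = k" using gk by (metis inv_closed inv_equality inv_inv)
qed

section \<open>Elements exchanging zero and infinity\<close>

definition swap :: "'a \<Rightarrow> bool" where
  "swap t \<longleftrightarrow> t \<in> carrier G \<and> conj_set G t P = Q \<and> conj_set G t Q = P"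

lemma exists_swap: "\<exists>t. swap t"
  using syl11_swap[OF P Q PQ] unfolding swap_def by metis

lemma swap_perm:
  assumes "swap t" shows "perm t 0 = 11" "perm t 11 = 0"
  using assms unfolding swap_def by (intro perm_eqI; simp add: lab_special)+

lemma swap_mult_h:
  assumes "swap t" shows "swap (t \<otimes> h [^] (k::nat))"
  using assms carr by (simp add: swap_def conj_set_mult h_pow_normalizes)

text \<open>A fixed point would put \<open>t\<close> into a point stabilizer, of odd order 55. But
  odd powers of \<open>t\<close> still exchange 0 and infinity, so the 55th is not trivial.\<close>

lemma swap_no_fixed_point:
  assumes t: "swap t" and i: "i < 12"
  shows "perm t i \<noteq> i"
proof
  assume fixed: "perm t i = i"
  have tG: "t \<in> carrier G" using t by (simp add: swap_def)
  let ?N = "set_normalizer G (lab i)"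
  have N: "subgroup ?N G" using lab_subset[OF i] by (rule subgroup_set_normalizer)
  have "conj_set G t (lab i) = lab i" using lab_perm[OF tG i] fixed by simp
  then have tN: "t \<in> ?N" using tG by (simp add: set_normalizer_def)
  interpret N: group "G\<lparr>carrier := ?N\<rparr>" using N by (rule subgroup_imp_group)
  have "t [^] (55::nat) = \<one>"
    using N.pow_order_eq_1[of t] tN card_set_normalizer_syl11(1)[OF lab_mem[OF i]]
    by (simp add: order_def flip: nat_pow_consistent)
  have even: "perm (t [^] (2 * m)) 11 = 11" for m :: nat
  proof (induction m)
    case (Suc m)
    have "t [^] (2 * Suc m) = t \<otimes> (t \<otimes> t [^] (2 * m))"
      using tG nat_pow_Suc2[OF tG, of "2 * m"] nat_pow_Suc2[OF tG, of "Suc (2 * m)"] by simp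
    then show ?case using Suc tG swap_perm[OF t] by (simp add: perm_mult perm_lt)
  qed (simp add: perm_one)
  have "t [^] (55::nat) = t \<otimes> t [^] (2 * 27 :: nat)"
    using nat_pow_Suc2[OF tG, of 54] by simp
  then have "perm (t [^] (55::nat)) 11 = 0"
    using even[of 27] perm_mult[OF tG nat_pow_closed[OF tG, of "2 * 27"], of 11] swap_perm[OF t] by simp
  then show False using \<open>t [^] 55 = \<one>\<close> by (simp add: perm_one)
qed

text \<open>\<open>t\<close> normalizes the two-point stabilizer generated by \<open>h\<close>, so
  it conjugates \<open>h\<close> to some \<open>h [^] s\<close>. The square of \<open>t\<close> lies
  in that stabilizer and commutes with \<open>h\<close>, whence \<open>s * s = 1\<close> modulo
  5.\<close>

lemma swap_h:
  assumes t: "swap t"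
  obtains s where "s = 1 \<or> s = (4::nat)" "t \<otimes> h = h [^] s \<otimes> t"
proof -
  let ?H = "set_normalizer G P \<inter> set_normalizer G Q"
  have tG: "t \<in> carrier G" and tP: "conj_set G t P = Q" and tQ: "conj_set G t Q = P"
    using t by (auto simp: swap_def)
  have hP: "conj_set G h P = P" "conj_set G h Q = Q"
    using h(1) by (simp_all add: set_normalizer_def)
  have iP: "conj_set G (inv t) Q = P" "conj_set G (inv t) P = Q"
    using conj_set_inv(1)[OF tG carr(3)] conj_set_inv(1)[OF tG carr(4)] tP tQ by simp_all
  have "t \<otimes> h \<otimes> inv t \<in> ?H"
    using tG carr tP tQ hP iP by (simp add: set_normalizer_def conj_set_mult)
  then obtain s :: nat where s: "s < 5" "t \<otimes> h \<otimes> inv t = h [^] s" unfolding stab by blast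
  then have th: "t \<otimes> h = h [^] s \<otimes> t" using tG carr by (simp add: inv_solve_right')
  have "t \<otimes> t \<in> ?H" using tG carr tP tQ by (simp add: set_normalizer_def conj_set_mult)
  then obtain j :: nat where j: "t \<otimes> t = h [^] j" unfolding stab by blast
  have "h = t \<otimes> t \<otimes> h \<otimes> inv (t \<otimes> t)"
    unfolding j using carr group_commutes_pow[of h h j] by (simp add: m_assoc)
  also have "\<dots> = t \<otimes> (t \<otimes> h \<otimes> inv t) \<otimes> inv t" using tG carr by (simp add: m_assoc inv_mult_group)
  also have "\<dots> = h [^] (s * s)"
    using conj_pow[of t h s] s(2) tG carr by (simp add: nat_pow_pow)
  finally have "h [^] (1::nat) = h [^] (s * s)" using carr by simp
  then have "h [^] int 1 = h [^] int (s * s)" by (simp only: int_pow_int)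
  then have "[s * s = 1] (mod 5)"
    using int_pow_eq[OF carr(2)] h(2) by (metis cong_iff_dvd_diff cong_int_iff)
  then have "s * s mod 5 = 1" by (simp add: cong_def)
  moreover have "s = 0 \<or> s = 1 \<or> s = 2 \<or> s = 3 \<or> s = 4" using s(1) by arith
  ultimately have "s = 1 \<or> s = 4" by auto
  then show thesis using that th by blast
qed

lemma swap_h_pow:
  assumes "t \<in> carrier G" "t \<otimes> h = h [^] s \<otimes> t"
  shows "t \<otimes> h [^] (k::nat) = h [^] (s * k :: nat) \<otimes> t"
proof (induction k)
  case (Suc k)
  have "t \<otimes> h [^] Suc k = h [^] (s * k) \<otimes> (t \<otimes> h)"
    using Suc assms(1) carr by (simp add: m_assoc[symmetric])
  also have "\<dots> = h [^] (s * k) \<otimes> h [^] s \<otimes> t"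
    unfolding assms(2) using assms(1) carr by (simp add: m_assoc)
  also have "\<dots> = h [^] (s * Suc k) \<otimes> t"
    using carr by (simp add: nat_pow_mult add.commute)
  finally show ?case .
qed (use assms carr in simp)

text \<open>Multiplying by powers of \<open>h\<close> scales the image of 1 by squares, which brings
  it to 1 or to 10 = -1; the value 1 would be a fixed point.\<close>

lemma exists_normalized_swap: "\<exists>t. swap t \<and> perm t 1 = 10"
proof -
  obtain t where t: "swap t" using exists_swap by blast
  then have tG: "t \<in> carrier G" by (simp add: swap_def)
  obtain s where s: "s = 1 \<or> s = (4::nat)" "t \<otimes> h = h [^] s \<otimes> t" using swap_h[OF t] by blast
  define c where "c = perm t 1"
  have "c < 12" using perm_lt[OF tG, of 1] by (simp add: c_def)
  moreover have "c \<noteq> 0" "c \<noteq> 11"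
    using perm_inj[OF tG, of 1 11] perm_inj[OF tG, of 1 0] swap_perm[OF t] by (auto simp: c_def)
  ultimately have c: "c \<in> {1, 2, 3, 4, 5, 6, 7, 8, 9, 10}" by simp arith
  have eq: "perm (t \<otimes> h [^] k) 1 = 4 ^ (s * k) * c mod 11" for k :: nat
  proof -
    have "perm (t \<otimes> h [^] k) 1 = perm (h [^] (s * k)) c"
      unfolding swap_h_pow[OF tG s(2)] c_def using tG carr by (simp add: perm_mult)
    moreover have "c < 11" using c by auto
    ultimately show ?thesis by (simp add: perm_h_pow)
  qed
  \<comment> \<open>Both 4 and \<open>4 ^ 4\<close> generate the nonzero squares modulo 11, and -1
    is not a square, so 1 and 10 represent the two cosets.\<close>
  have "\<forall>c\<in>{1, 2, 3, 4, 5, 6, 7, 8, 9, 10}. \<forall>s\<in>{1, 4}. \<exists>k\<in>{0, 1, 2, 3, 4}.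
      4 ^ (s * k) * c mod 11 = 1 \<or> 4 ^ (s * k) * c mod 11 = (10::nat)"
    by simp
  then obtain k where "4 ^ (s * k) * c mod 11 = 1 \<or> 4 ^ (s * k) * c mod 11 = (10::nat)"
    using c s(1) by blast
  then have "perm (t \<otimes> h [^] k) 1 = 10"
    using swap_no_fixed_point[OF swap_mult_h[OF t], of 1 k] eq[of k] by auto
  then show ?thesis using swap_mult_h[OF t] by blast
qed


text \<open>The word \<open>(p t)\<^sup>3\<close> fixes \<open>0\<close>, \<open>1\<close> and infinity, so it is trivial; this relation singles out
  \<open>t(x) = - 1 / x\<close> among the ten permutations allowed by the commutation with \<open>h\<close>.\<close>

lemma normalized_swap_perm:
  assumes t: "swap t" and t1: "perm t 1 = 10" and i: "i < 12"
  shows "perm t i = [11, 10, 5, 7, 8, 2, 9, 3, 4, 6, 1, 0] ! i"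
proof -
  have tG: "t \<in> carrier G" using t by (simp add: swap_def)
  obtain s where s: "s = 1 \<or> s = (4::nat)" "t \<otimes> h = h [^] s \<otimes> t" using swap_h[OF t] by blast
  define T where "T = perm t"
  define A where "A i = (if i < 11 then (i + 1) mod 11 else 11)" for i :: nat
  have T0: "T 0 = 11" "T 11 = 0" "T 1 = 10" using swap_perm[OF t] t1 by (simp_all add: T_def)
  have Tlt: "T i < 12" if "i < 12" for i using that perm_lt[OF tG] by (simp add: T_def)
  have Tinj: "T i \<noteq> T j" if "i < 12" "j < 12" "i \<noteq> j" for i j
    using that perm_inj[OF tG] by (auto simp: T_def)
  \<comment> \<open>Commutation with \<open>h\<close> determines \<open>T\<close> on the squares 1,
    4, 5, 9, 3 from \<open>T 1 = 10\<close>, and on the nonsquares 2, 8, 10, 7, 6 from the single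
    value \<open>T 2\<close>.\<close>
  have step: "T j = 4 ^ (s * k) * T i mod 11" if "0 < i" "i < 11" "4 ^ k * i mod 11 = j" for i j k
  proof -
    have "perm (t \<otimes> h [^] k) i = perm (h [^] (s * k) \<otimes> t) i" by (simp only: swap_h_pow[OF tG s(2)])
    moreover have "perm (h [^] k) i = j"
      using perm_h_pow[of i k] that by simp
    moreover have "T i < 11" using Tlt[of i] Tinj[of i 0] T0 that by simp
    ultimately show ?thesis
      using that tG carr by (simp add: perm_mult perm_h_pow perm_lt T_def)
  qed
  have perm_pt: "perm (p \<otimes> t) i = A (T i)" if "i < 12" for i
    using that tG carr perm_lt[OF tG that] by (simp add: perm_mult perm_p T_def A_def)
  define u where "u = p \<otimes> t"
  have uG: "u \<in> carrier G" using tG carr by (simp add: u_def)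
  have perm_uuu: "perm (u \<otimes> (u \<otimes> u)) i = A (T (A (T (A (T i)))))" if "i < 12" for i
    using that uG perm_lt[OF uG] perm_pt by (simp add: perm_mult flip: u_def)
  \<comment> \<open>The element \<open>u\<close> sends 0 to infinity, infinity to 1 and 1 to 0, so
    its cube fixes all three points.\<close>
  have "u \<otimes> (u \<otimes> u) = \<one>"
    by (rule perm_fixes_three) (use uG T0 in \<open>simp_all add: perm_uuu A_def\<close>)
  then have rel: "A (T (A (T (A (T i))))) = i" if "i < 12" for i
    using perm_uuu[OF that] that by (simp add: perm_one)
  define e where "e = T 2"
  have e1: "T 4 = 4 ^ (s * 1) * 10 mod 11" "T 5 = 4 ^ (s * 2) * 10 mod 11"
    "T 9 = 4 ^ (s * 3) * 10 mod 11" "T 3 = 4 ^ (s * 4) * 10 mod 11"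
    unfolding T0(3)[symmetric] by (rule step; simp)+
  have e2: "T 8 = 4 ^ (s * 1) * e mod 11" "T 10 = 4 ^ (s * 2) * e mod 11"
    "T 7 = 4 ^ (s * 3) * e mod 11" "T 6 = 4 ^ (s * 4) * e mod 11"
    unfolding e_def by (rule step; simp)+
  have ne: "T 2 \<noteq> T 0" "T 2 \<noteq> T 11" "T 2 \<noteq> T 1" "T 2 \<noteq> T 4" "T 2 \<noteq> T 5" "T 2 \<noteq> T 9" "T 2 \<noteq> T 3"
    by (rule Tinj; simp)+
  have T2: "T 2 \<in> {0, 1, 2, 3, 4, 5, 6, 7, 8, 9, 10, 11}" using Tlt[of 2] by simp arith
  have "i \<in> {0, 1, 2, 3, 4, 5, 6, 7, 8, 9, 10, 11}" using i by simp arith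
  from s(1) have "T i = [11, 10, 5, 7, 8, 2, 9, 3, 4, 6, 1, 0] ! i"
  proof
    assume s1: "s = 1"
    have T1: "T 4 = 7" "T 5 = 6" "T 9 = 2" "T 3 = 8" unfolding e1 s1 by simp_all
    note T = T0 T1 e2[unfolded s1] e_def[symmetric]
    \<comment> \<open>The squares already occupy the five nonsquare values, so injectivity leaves
      the squares for \<open>e\<close>. For \<open>s = 1\<close> the relation at 2 and 3 rejects
      them all; for \<open>s = 4\<close> it leaves 5, which is -1/2 modulo 11.\<close>
    have "e \<in> {1, 3, 4, 5, 9}" using T2 ne unfolding T0 T1 e_def[symmetric] by auto
    then have False
      using rel[of 2] rel[of 3] by (elim insertE; simp add: T A_def)
    then show ?thesis ..
  next
    assume s4: "s = 4"
    have T1: "T 4 = 8" "T 5 = 2" "T 9 = 6" "T 3 = 7" unfolding e1 s4 by simp_all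
    note T = T0 T1 e2[unfolded s4] e_def[symmetric]
    have "e \<in> {1, 3, 4, 5, 9}" using T2 ne unfolding T0 T1 e_def[symmetric] by auto
    then have "e = 5"
      using rel[of 2] rel[of 3] by (elim insertE; simp add: T A_def)
    then show ?thesis
      using \<open>i \<in> _\<close> by (elim insertE; simp add: T T0(3)[unfolded One_nat_def])
  qed
  then show ?thesis by (simp add: T_def)
qed

text \<open>A Bruhat decomposition: the normalizer of \<open>P\<close> is generated by
  \<open>p\<close> and \<open>h\<close>, and an element moving \<open>P\<close> agrees on it with
  some \<open>x \<otimes> t\<close> for \<open>x\<close> in \<open>P\<close>, hence differs from it
  by an element of the normalizer.\<close>

lemma generate_eq_carrier:
  assumes t: "swap t"
  shows "generate G {p, h, t} = carrier G"
proof
  let ?K = "generate G {p, h, t}"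
  have tG: "t \<in> carrier G" using t by (simp add: swap_def)
  have K: "subgroup ?K G" by (rule generate_is_subgroup) (use tG carr in auto)
  show "?K \<subseteq> carrier G" using K by (rule subgroup.subset)
  have gen: "p \<in> ?K" "h \<in> ?K" "t \<in> ?K" by (auto intro: generate.incl)
  have NK: "set_normalizer G P \<subseteq> ?K"
  proof
    fix g assume "g \<in> set_normalizer G P"
    then obtain x y where xy: "g = x \<otimes> y" "x \<in> P" "y \<in> set_normalizer G P \<inter> set_normalizer G Q"
      using set_normalizer_factor[OF P Q PQ] unfolding bij_betw_def by force
    obtain i :: nat where "x = p [^] i" using xy(2) syl11_powers(2)[OF P p] by blast
    moreover obtain j :: nat where "y = h [^] j" using xy(3) unfolding stab by blast
    ultimately show "g \<in> ?K"
      using xy(1) subgroup_nat_pow_closed[OF K] gen subgroup.m_closed[OF K] by simp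
  qed
  show "carrier G \<subseteq> ?K"
  proof
    fix g assume g: "g \<in> carrier G"
    show "g \<in> ?K"
    proof (cases "conj_set G g P = P")
      case True
      then show ?thesis using NK g by (auto simp: set_normalizer_def)
    next
      case False
      then obtain x where x: "x \<in> P" "conj_set G x Q = conj_set G g P"
        using syl11_move[OF P Q syl11_conj[OF g P]] PQ by metis
      have xG: "x \<in> carrier G" using x(1) carr by blast
      have "x \<in> ?K" using x(1) NK subset_set_normalizer P by (auto simp: syl11_def)
      then have xtK: "x \<otimes> t \<in> ?K" using gen subgroup.m_closed[OF K] by blast
      have "conj_set G (x \<otimes> t) P = conj_set G g P"
        using x(2) t xG tG carr by (simp add: conj_set_mult swap_def)
      then have "conj_set G (inv (x \<otimes> t) \<otimes> g) P = P"
        using conj_set_inv(1)[of "x \<otimes> t" P] xG tG g carr by (simp only: conj_set_mult m_closed inv_closed)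
      then have "inv (x \<otimes> t) \<otimes> g \<in> ?K"
        using NK xG tG g by (auto simp: set_normalizer_def)
      then have "x \<otimes> t \<otimes> (inv (x \<otimes> t) \<otimes> g) \<in> ?K" using xtK subgroup.m_closed[OF K] by blast
      moreover have "x \<otimes> t \<otimes> (inv (x \<otimes> t) \<otimes> g) = g" using xG tG g by (simp add: m_assoc[symmetric] del: inv_mult_group)
      ultimately show ?thesis by simp
    qed
  qed
qed

end

text \<open>In the list, the entry at a nonzero residue \<open>i\<close> is -1/i modulo 11, while 0
  and 11 (infinity) are exchanged. The carrier is given by generators, so that it depends on no
  particular group \<open>G\<close>.\<close>

definition projective_line_group :: "(nat \<Rightarrow> nat) monoid" where
  "projective_line_group = (BijGroup {..<12})\<lparr>carrier := generate (BijGroup {..<12})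
    {\<lambda>i\<in>{..<12}. if i < 11 then (i + 1) mod 11 else 11,
     \<lambda>i\<in>{..<12}. if i < 11 then 4 * i mod 11 else 11,
     \<lambda>i\<in>{..<12}. [11, 10, 5, 7, 8, 2, 9, 3, 4, 6, 1, 0] ! i}\<rparr>"

context framed_pattern
begin

text \<open>Whatever frame and swap were chosen, \<open>p\<close>, \<open>h\<close> and
  \<open>t\<close> act by the same three permutations; since they generate \<open>G\<close>, the
  faithful image is the group generated by those permutations.\<close>

lemma iso_projective_line_group: "G \<cong> projective_line_group"
proof -
  let ?B = "BijGroup {..<12::nat}"
  obtain t where t: "swap t" "perm t 1 = 10" using exists_normalized_swap by blast
  have tG: "t \<in> carrier G" using t by (simp add: swap_def)
  interpret group_hom G ?B perm
    using perm_hom is_group group_BijGroup by (intro group_hom.intro group_hom_axioms.intro)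
  have restr: "perm g = (\<lambda>i\<in>{..<12}. perm g i)" for g by (rule ext) (simp add: perm_def)
  have "perm p = (\<lambda>i\<in>{..<12}. if i < 11 then (i + 1) mod 11 else 11)"
    by (subst restr) (auto intro!: restrict_ext simp: perm_p)
  moreover have "perm h = (\<lambda>i\<in>{..<12}. if i < 11 then 4 * i mod 11 else 11)"
    using perm_h_pow[of _ 1] carr by (subst restr) (auto intro!: restrict_ext)
  moreover have "perm t = (\<lambda>i\<in>{..<12}. [11, 10, 5, 7, 8, 2, 9, 3, 4, 6, 1, 0] ! i)"
    by (subst restr) (auto intro!: restrict_ext simp: normalized_swap_perm[OF t])
  moreover have "generate ?B (perm ` {p, h, t}) = perm ` carrier G"
    using generate_img[of "{p, h, t}"] carr tG generate_eq_carrier[OF t(1)] by simp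
  ultimately have M: "projective_line_group = ?B\<lparr>carrier := perm ` carrier G\<rparr>"
    by (simp add: projective_line_group_def)
  have "perm \<in> iso G projective_line_group"
    unfolding M iso_def using perm_hom perm_faithful by (auto simp: hom_def bij_betw_def)
  then show ?thesis by (auto simp: is_iso_def)
qed

end

theorem Exp_rho_imp_iso:
  fixes G :: "('a, 'b) monoid_scheme"
  assumes "group G" "finite (carrier G)" "Exp_rho G = {120, 165, 220, 264}"
  shows "G \<cong> projective_line_group"
proof -
  interpret exponent_pattern G
    using assms group.order_of_Exp_rho[OF assms] by (intro exponent_pattern.intro exponent_pattern_axioms.intro)
  obtain P where P: "P \<in> syl11" using exists_syl11 by blast
  obtain Q where Q: "Q \<in> syl11" "P \<noteq> Q" using exists_two_syl11[OF P] by metis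
  obtain p where p: "p \<in> P" "p \<noteq> \<one>\<^bsub>G\<^esub>" using exists_nontrivial[OF P] by blast
  obtain h where h: "h \<in> set_normalizer G P \<inter> set_normalizer G Q" "group.ord G h = 5"
    "h \<otimes>\<^bsub>G\<^esub> p \<otimes>\<^bsub>G\<^esub> inv\<^bsub>G\<^esub> h = p [^]\<^bsub>G\<^esub> (4::nat)"
    "set_normalizer G P \<inter> set_normalizer G Q = (\<lambda>i. h [^]\<^bsub>G\<^esub> i) ` {..<5::nat}"
    using exists_torus_generator[OF P Q p] by blast
  interpret framed_pattern G P Q p h
    by unfold_locales (use P Q p h in auto)
  show ?thesis by (rule iso_projective_line_group)
qed

subsection \<open>Element orders in PSL(2,11)\<close>

abbreviation SL2 :: "(11 ^ 2 ^ 2) monoid" where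
  "SL2 \<equiv> special_linear_group"

abbreviation scalar_matrix :: "11 ^ 2 ^ 2 \<Rightarrow> bool" where
  "scalar_matrix A \<equiv> A $ 1 $ 2 = 0 \<and> A $ 2 $ 1 = 0 \<and> A $ 1 $ 1 = A $ 2 $ 2"

lemma UNIV_11: "(UNIV :: 11 set) = {0, 1, 2, 3, 4, 5, 6, 7, 8, 9, 10}"
proof -
  have "x \<in> {0, 1, 2, 3, 4, 5, 6, 7, 8, 9, 10}" for x :: 11
  proof (cases x)
    case (of_int z)
    then have "z \<in> {0, 1, 2, 3, 4, 5, 6, 7, 8, 9, 10}" by simp arith
    then show ?thesis using of_int(1) by (elim insertE) simp_all
  qed
  then show ?thesis by blast
qed

lemma sum_11: "(\<Sum>x::11\<in>UNIV. f x) = f 0 + f 1 + f 2 + f 3 + f 4 + f 5 + f 6 + f 7 + f 8 + f 9 + f 10"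
  for f :: "11 \<Rightarrow> nat"
  unfolding UNIV_11 by simp

lemma forall_11: "(\<forall>x::11. Q x) \<longleftrightarrow> Q 0 \<and> Q 1 \<and> Q 2 \<and> Q 3 \<and> Q 4 \<and> Q 5 \<and> Q 6 \<and> Q 7 \<and> Q 8 \<and> Q 9 \<and> Q 10"
proof -
  have "(\<forall>x::11. Q x) \<longleftrightarrow> (\<forall>x\<in>{0, 1, 2, 3, 4, 5, 6, 7, 8, 9, 10}. Q x)"
    unfolding UNIV_11[symmetric] by blast
  then show ?thesis by simp
qed

lemma mult_eq_0_11:
  fixes x y :: 11
  assumes "x * y = 0" "x \<noteq> 0"
  shows "y = 0"
proof -
  obtain z where "x * z = 1" using inverse_mod_11[OF assms(2)] by blast
  then have "y = (x * z) * y" by simp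
  also have "\<dots> = z * (x * y)" by (simp only: ac_simps)
  finally show ?thesis using assms(1) by simp
qed

lemma square_eq_1_11: "x * x = 1 \<longleftrightarrow> x = 1 \<or> x = 10" for x :: 11
proof -
  have "\<forall>x::11. x * x = 1 \<longleftrightarrow> x = 1 \<or> x = 10" unfolding forall_11 by simp
  then show ?thesis ..
qed

text \<open>For nonzero \<open>v\<close> the factor \<open>b\<close> is any of 10 units and fixes
  \<open>c\<close>; for 0 one factor vanishes, in 11 + 11 - 1 ways.\<close>

lemma count_products_11: "(\<Sum>b::11\<in>UNIV. \<Sum>c\<in>UNIV. if b * c = v then 1 else 0) = (if v = 0 then 21 else 10 :: nat)"
proof -
  have "\<forall>v. (\<Sum>b::11\<in>UNIV. \<Sum>c\<in>UNIV. if b * c = v then 1 else 0) = (if v = 0 then 21 else 10 :: nat)"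
    unfolding forall_11 sum_11 by simp
  then show ?thesis ..
qed

lemma SL2_carrier: "A \<in> carrier SL2 \<longleftrightarrow> A $ 1 $ 1 * A $ 2 $ 2 - A $ 1 $ 2 * A $ 2 $ 1 = 1"
  by (simp add: special_linear_group_def det_2)

lemma SL2_mult: "A \<otimes>\<^bsub>SL2\<^esub> B = A ** B"
  by (simp add: special_linear_group_def)

lemma group_SL2: "group SL2"
  by (rule group_special_linear_group_2)

text \<open>Commuting with the upper and the lower elementary matrix already forces a matrix to be
  scalar.\<close>

lemma center_SL2: "group_center SL2 = {A \<in> carrier SL2. scalar_matrix A}"
proof (intro equalityI subsetI)
  fix A assume A: "A \<in> group_center SL2"
  define E F :: "11 ^ 2 ^ 2" where "E = vector [vector [1, 1], vector [0, 1]]"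
    and "F = vector [vector [1, 0], vector [1, 1]]"
  have "E \<in> carrier SL2" "F \<in> carrier SL2" by (simp_all add: SL2_carrier E_def F_def)
  then have "A ** E = E ** A" "A ** F = F ** A" using A by (auto simp: group_center_def SL2_mult)
  then have "scalar_matrix A"
    by (simp add: vec_eq_iff forall_2 matrix_matrix_mult_def sum_2 E_def F_def)
  then show "A \<in> {A \<in> carrier SL2. scalar_matrix A}" using A by (simp add: group_center_def)
next
  fix A assume "A \<in> {A \<in> carrier SL2. scalar_matrix A}"
  then show "A \<in> group_center SL2"
    by (auto simp: group_center_def SL2_mult vec_eq_iff forall_2 matrix_matrix_mult_def sum_2 mult.commute)
qed

lemma card_center_SL2: "card (group_center SL2) = 2"
proof -
  have "group_center SL2 = {mat 1, mat 10}"
    unfolding center_SL2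
    by (auto simp: SL2_carrier vec_eq_iff forall_2 mat_def square_eq_1_11)
  moreover have "mat 1 \<noteq> (mat 10 :: 11 ^ 2 ^ 2)" by (simp add: vec_eq_iff forall_2 mat_def)
  ultimately show ?thesis by simp
qed

text \<open>By the Cayley-Hamilton theorem the powers of a matrix of determinant 1 and trace \<open>t\<close> are combinations
  of the matrix and the identity, with coefficients the Chebyshev polynomials in \<open>t\<close>.\<close>

fun cheb :: "11 \<Rightarrow> nat \<Rightarrow> 11" where
  "cheb t 0 = 0"
| "cheb t (Suc 0) = 1"
| "cheb t (Suc (Suc k)) = t * cheb t (Suc k) - cheb t k"

lemma SL2_pow:
  assumes A: "A \<in> carrier SL2"
  defines "t \<equiv> A $ 1 $ 1 + A $ 2 $ 2"
  shows "(A [^]\<^bsub>SL2\<^esub> Suc k) $ i $ j = cheb t (Suc k) * A $ i $ j - (if i = j then cheb t k else 0)"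
proof -
  interpret group SL2 by (rule group_SL2)
  \<comment> \<open>The Cayley-Hamilton relation enters through this rewriting of the determinant
    condition; \<open>det_mult\<close> is its form inside longer products.\<close>
  have det: "A $ 1 $ 2 * A $ 2 $ 1 = A $ 1 $ 1 * A $ 2 $ 2 - 1"
    using A by (simp add: SL2_carrier algebra_simps)
  have det_mult: "A $ 1 $ 2 * (A $ 2 $ 1 * x) = A $ 1 $ 1 * (A $ 2 $ 2 * x) - x" for x
    by (simp add: mult.assoc[symmetric] det left_diff_distrib)
  have "\<forall>i j. (A [^]\<^bsub>SL2\<^esub> Suc k) $ i $ j = cheb t (Suc k) * A $ i $ j - (if i = j then cheb t k else 0)"
  proof (induction k)
    case 0
    then show ?case using A by simp
  next
    case (Suc k)
    define B where "B = A [^]\<^bsub>SL2\<^esub> Suc k"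
    have B: "B $ i $ j = cheb t (Suc k) * A $ i $ j - (if i = j then cheb t k else 0)" for i j
      using Suc by (simp add: B_def)
    have "A [^]\<^bsub>SL2\<^esub> Suc (Suc k) = B ** A" by (simp add: B_def SL2_mult)
    moreover have "(B ** A) $ i $ j = cheb t (Suc (Suc k)) * A $ i $ j - (if i = j then cheb t (Suc k) else 0)" for i j
    proof -
      have "\<forall>i j. (B ** A) $ i $ j = cheb t (Suc (Suc k)) * A $ i $ j - (if i = j then cheb t (Suc k) else 0)"
        by (simp add: forall_2 matrix_matrix_mult_def sum_2 B t_def algebra_simps det_mult)
      then show ?thesis by blast
    qed
    ultimately show ?case by simp
  qed
  then show ?thesis by blast
qed

text \<open>The power differs from \<open>?c\<close> times \<open>A\<close> by a scalar matrix; as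
  \<open>A\<close> is not scalar and the field has no zero divisors, it is scalar exactly when
  \<open>?c\<close> vanishes.\<close>

lemma SL2_pow_center_iff:
  assumes A: "A \<in> carrier SL2" "\<not> scalar_matrix A" and k: "k > 0"
  shows "A [^]\<^bsub>SL2\<^esub> k \<in> group_center SL2 \<longleftrightarrow> cheb (A $ 1 $ 1 + A $ 2 $ 2) k = 0"
proof -
  interpret group SL2 by (rule group_SL2)
  obtain m where m: "k = Suc m" using k by (cases k) auto
  let ?c = "cheb (A $ 1 $ 1 + A $ 2 $ 2) k"
  have "A [^]\<^bsub>SL2\<^esub> k \<in> group_center SL2 \<longleftrightarrow> ?c * A $ 1 $ 2 = 0 \<and> ?c * A $ 2 $ 1 = 0 \<and> ?c * A $ 1 $ 1 = ?c * A $ 2 $ 2"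
    using A(1) unfolding center_SL2 m by (simp only: mem_Collect_eq nat_pow_closed SL2_pow) simp
  also have "\<dots> \<longleftrightarrow> ?c = 0"
    using A(2) mult_eq_0_11[of ?c "A $ 1 $ 2"] mult_eq_0_11[of ?c "A $ 2 $ 1"]
      mult_eq_0_11[of ?c "A $ 1 $ 1 - A $ 2 $ 2"] by (auto simp: right_diff_distrib)
  finally show ?thesis .
qed

abbreviation to_PSL :: "11 ^ 2 ^ 2 \<Rightarrow> (11 ^ 2 ^ 2) set" where
  "to_PSL A \<equiv> group_center SL2 #>\<^bsub>SL2\<^esub> A"

lemma PSL_eq: "PSL_2_11 = SL2 Mod group_center SL2"
  by (simp add: PSL_2_11_def projective_special_linear_group_def)

lemma to_PSL_carrier: "A \<in> carrier SL2 \<Longrightarrow> to_PSL A \<in> carrier PSL_2_11"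
  by (auto simp: PSL_eq FactGroup_def RCOSETS_def)

lemma to_PSL_pow_eq_one_iff:
  assumes "A \<in> carrier SL2"
  shows "to_PSL A [^]\<^bsub>PSL_2_11\<^esub> (k::nat) = \<one>\<^bsub>PSL_2_11\<^esub> \<longleftrightarrow> A [^]\<^bsub>SL2\<^esub> k \<in> group_center SL2"
proof -
  interpret Z: normal "group_center SL2" SL2 by (rule normal_group_center[OF group_SL2])
  have sub: "subgroup (group_center SL2) SL2" by (rule Z.subgroup_axioms)
  have "to_PSL A [^]\<^bsub>PSL_2_11\<^esub> k = to_PSL (A [^]\<^bsub>SL2\<^esub> k)"
    unfolding PSL_eq
    by (rule hom_nat_pow[OF Z.r_coset_hom_Mod assms group_SL2 Z.factorgroup_is_group, symmetric])
  moreover have "\<one>\<^bsub>PSL_2_11\<^esub> = group_center SL2" by (simp add: PSL_eq FactGroup_def)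
  moreover have "to_PSL (A [^]\<^bsub>SL2\<^esub> k) = group_center SL2 \<longleftrightarrow> A [^]\<^bsub>SL2\<^esub> k \<in> group_center SL2"
    using Z.coset_join1[OF _ _ sub] Z.coset_join2[OF _ sub] Z.nat_pow_closed[OF assms] by blast
  ultimately show ?thesis by simp
qed

text \<open>The least positive \<open>k\<close> with \<open>cheb t k = 0\<close>. Opposite traces
  agree, because \<open>A\<close> and its negative have the same image in the quotient.\<close>

definition trace_order :: "11 \<Rightarrow> nat" where
  "trace_order t = (if t = 0 then 2 else if t \<in> {1, 10} then 3 else if t \<in> {2, 9} then 11
    else if t \<in> {5, 6} then 6 else 5)"

text \<open>For a nonscalar matrix the order is not 1, so a zero of \<open>cheb\<close> at a prime
  index determines it; the only composite value, 6, needs the divisors 2 and 3 excluded.\<close>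

lemma ord_to_PSL:
  assumes A: "A \<in> carrier SL2"
  shows "group.ord PSL_2_11 (to_PSL A) = (if scalar_matrix A then 1 else trace_order (A $ 1 $ 1 + A $ 2 $ 2))"
proof -
  interpret group PSL_2_11 by (rule group_PSL_2_11)
  interpret S: group SL2 by (rule group_SL2)
  let ?X = "to_PSL A" and ?t = "A $ 1 $ 1 + A $ 2 $ 2"
  have X: "?X \<in> carrier PSL_2_11" using A by (rule to_PSL_carrier)
  have dvd: "ord ?X dvd k \<longleftrightarrow> A [^]\<^bsub>SL2\<^esub> k \<in> group_center SL2" for k
    using to_PSL_pow_eq_one_iff[OF A, of k] pow_eq_id[OF X, of k] by simp
  show ?thesis
  proof (cases "scalar_matrix A")
    case True
    then have "ord ?X dvd 1" unfolding dvd using A by (simp add: center_SL2)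
    then show ?thesis using True by simp
  next
    case False
    have dvd': "ord ?X dvd k \<longleftrightarrow> cheb ?t k = 0" if "k > 0" for k
      using dvd SL2_pow_center_iff[OF A False that] by simp
    have "ord ?X \<noteq> 1" using dvd'[of 1] by (metis One_nat_def cheb.simps(2) dvd_refl zero_less_one zero_neq_one)
    then have pr: "ord ?X = k" if "prime k" "cheb ?t k = 0" for k
      using that dvd'[of k] prime_gt_0_nat[of k] by (metis prime_nat_iff)
    have six: "ord ?X = 6" if "cheb ?t 6 = 0" "cheb ?t 2 \<noteq> 0" "cheb ?t 3 \<noteq> 0"
    proof -
      have 1: "ord ?X dvd 6" "\<not> ord ?X dvd 2" "\<not> ord ?X dvd 3" using that dvd' by simp_all
      then have "ord ?X \<le> 6" by (intro dvd_imp_le) simp_all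
      then have "ord ?X = 0 \<or> ord ?X = 1 \<or> ord ?X = 2 \<or> ord ?X = 3 \<or> ord ?X = 4 \<or> ord ?X = 5 \<or> ord ?X = 6" by arith
      then show ?thesis using 1 by (elim disjE) simp_all
    qed
    have "\<forall>t. (trace_order t = 6 \<and> cheb t 6 = 0 \<and> cheb t 2 \<noteq> 0 \<and> cheb t 3 \<noteq> 0)
        \<or> (trace_order t \<in> {2, 3, 5, 11} \<and> cheb t (trace_order t) = 0)"
      unfolding forall_11 by (simp add: trace_order_def eval_nat_numeral)
    then have "ord ?X = trace_order ?t"
    proof (elim allE[of _ ?t] disjE conjE)
      assume "trace_order ?t \<in> {2, 3, 5, 11}" "cheb ?t (trace_order ?t) = 0"
      moreover from this(1) have "prime (trace_order ?t)" by (elim insertE) simp_all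
      ultimately show ?thesis using pr by blast
    qed (use six in simp)
    then show ?thesis by (simp only: if_not_P[OF False])
  qed
qed

section \<open>Counting matrices by trace\<close>

lemma finite_PSL: "finite (carrier PSL_2_11)"
  by simp

lemma sum_SL2_to_PSL:
  fixes f :: "(11 ^ 2 ^ 2) set \<Rightarrow> nat"
  shows "(\<Sum>A\<in>carrier SL2. f (to_PSL A)) = 2 * (\<Sum>X\<in>carrier PSL_2_11. f X)"
proof -
  interpret Z: normal "group_center SL2" SL2 by (rule normal_group_center[OF group_SL2])
  have sub: "subgroup (group_center SL2) SL2" by (rule Z.subgroup_axioms)
  have Zsub: "group_center SL2 \<subseteq> carrier SL2" using sub by (rule subgroup.subset)
  have "(\<Sum>A\<in>carrier SL2. f (to_PSL A)) =
      (\<Sum>X\<in>carrier PSL_2_11. \<Sum>A | A \<in> carrier SL2 \<and> to_PSL A = X. f (to_PSL A))"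
    by (rule sum.group[symmetric]) (use to_PSL_carrier in auto)
  also have "\<dots> = (\<Sum>X\<in>carrier PSL_2_11. 2 * f X)"
  proof (rule sum.cong)
    fix X assume X: "X \<in> carrier PSL_2_11"
    then have Xr: "X \<in> rcosets\<^bsub>SL2\<^esub> group_center SL2" by (simp add: PSL_eq FactGroup_def)
    then obtain B where B: "B \<in> carrier SL2" "X = to_PSL B" by (auto simp: RCOSETS_def)
    have "{A. A \<in> carrier SL2 \<and> to_PSL A = X} = X"
    proof (intro equalityI subsetI)
      fix A assume "A \<in> {A. A \<in> carrier SL2 \<and> to_PSL A = X}"
      then show "A \<in> X" using Z.rcos_self[OF _ sub] by blast
    next
      fix A assume "A \<in> X"
      then show "A \<in> {A. A \<in> carrier SL2 \<and> to_PSL A = X}"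
        using Z.repr_independence[OF _ B(1) sub] Z.r_coset_subset_G[OF Zsub B(1)] B by blast
    qed
    moreover have "(\<Sum>A | A \<in> carrier SL2 \<and> to_PSL A = X. f (to_PSL A)) =
        (\<Sum>A | A \<in> carrier SL2 \<and> to_PSL A = X. f X)"
      by (rule sum.cong) auto
    moreover have "card X = 2"
      using Z.card_rcosets_equal[OF Xr Zsub] card_center_SL2 by simp
    ultimately show "(\<Sum>A | A \<in> carrier SL2 \<and> to_PSL A = X. f (to_PSL A)) = 2 * f X"
      by simp
  qed simp
  finally show ?thesis by (simp add: sum_distrib_left)
qed

text \<open>The diagonal entries are summed outermost: once they are fixed, so is the trace, and the
  determinant condition prescribes the product of the other two.\<close>

lemma sum_matrices_2:
  fixes F :: "11 \<Rightarrow> 11 \<Rightarrow> 11 \<Rightarrow> 11 \<Rightarrow> nat"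
  shows "(\<Sum>A::11^2^2\<in>UNIV. F (A $ 1 $ 1) (A $ 1 $ 2) (A $ 2 $ 1) (A $ 2 $ 2)) =
    (\<Sum>a\<in>UNIV. \<Sum>d\<in>UNIV. \<Sum>b\<in>UNIV. \<Sum>c\<in>UNIV. F a b c d)"
proof -
  have "(\<Sum>A::11^2^2\<in>UNIV. F (A $ 1 $ 1) (A $ 1 $ 2) (A $ 2 $ 1) (A $ 2 $ 2)) =
    (\<Sum>(a, d, b, c)\<in>UNIV \<times> UNIV \<times> UNIV \<times> UNIV. F a b c d)"
    by (rule sum.reindex_bij_witness[where i = "\<lambda>(a, d, b, c). vector [vector [a, b], vector [c, d]]"
          and j = "\<lambda>A. (A $ 1 $ 1, A $ 2 $ 2, A $ 1 $ 2, A $ 2 $ 1)"])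
      (auto simp: vec_eq_iff forall_2)
  then show ?thesis by (simp add: sum.cartesian_product)
qed

text \<open>A given trace \<open>t\<close> occurs for 110 matrices plus 11 for each root
  \<open>a\<close> of \<open>a * (t - a) = 1\<close>, that is 110, 121 or 132 according to whether
  \<open>t * t - 4\<close> is a nonsquare, zero or a nonzero square. The two scalar matrices reduce
  121 to 120 at the traces 2 and 9. The factor 2 is the order of the center.\<close>

lemma ord_exponent_PSL:
  fixes p :: nat
  defines "g \<equiv> \<lambda>t. multiplicity p (trace_order t)"
  shows "2 * ord_exponent p PSL_2_11 = 110 * g 0 + 110 * (g 1 + g 10) + 120 * (g 2 + g 9)
    + 132 * (g 3 + g 8) + 132 * (g 4 + g 7) + 110 * (g 5 + g 6)"
proof -
  let ?w = "\<lambda>a b c d. if a * d - b * c = 1 \<and> \<not> (b = 0 \<and> c = 0 \<and> a = d) then g (a + d) else 0"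
  \<comment> \<open>\<open>?v\<close> is the contribution the scalar matrices would make; adding it
    back removes the exception in \<open>?w\<close>. The nested conditionals let the sums collapse
    one variable at a time.\<close>
  let ?v = "\<lambda>a (b::11) (c::11) d. if c = 0 then if b = 0 then if d = a then if a * d = 1 then g (a + d) else 0 else 0 else 0 else 0"
  have "2 * ord_exponent p PSL_2_11 = (\<Sum>A\<in>carrier SL2. multiplicity p (group.ord PSL_2_11 (to_PSL A)))"
    unfolding ord_exponent_def
    by (rule sum_SL2_to_PSL[of "\<lambda>X. multiplicity p (group.ord PSL_2_11 X)", symmetric])
  also have "\<dots> = (\<Sum>A\<in>carrier SL2. ?w (A $ 1 $ 1) (A $ 1 $ 2) (A $ 2 $ 1) (A $ 2 $ 2))"
  proof (rule sum.cong)
    fix A assume A: "A \<in> carrier SL2"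
    then have "A $ 1 $ 1 * A $ 2 $ 2 - A $ 1 $ 2 * A $ 2 $ 1 = 1" by (simp only: SL2_carrier)
    then show "multiplicity p (group.ord PSL_2_11 (to_PSL A)) = ?w (A $ 1 $ 1) (A $ 1 $ 2) (A $ 2 $ 1) (A $ 2 $ 2)"
      unfolding ord_to_PSL[OF A] by (simp only: g_def if_distrib[of "multiplicity p"] multiplicity_one) simp
  qed simp
  also have "\<dots> = (\<Sum>A::11^2^2\<in>UNIV. ?w (A $ 1 $ 1) (A $ 1 $ 2) (A $ 2 $ 1) (A $ 2 $ 2))"
    by (rule sum.mono_neutral_left) (auto simp: SL2_carrier)
  also have "\<dots> = (\<Sum>a\<in>UNIV. \<Sum>d\<in>UNIV. \<Sum>b\<in>UNIV. \<Sum>c\<in>UNIV. ?w a b c d)"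
    by (rule sum_matrices_2)
  finally have e: "2 * ord_exponent p PSL_2_11 = (\<Sum>a\<in>UNIV. \<Sum>d\<in>UNIV. \<Sum>b\<in>UNIV. \<Sum>c\<in>UNIV. ?w a b c d)" .
  have "(\<Sum>a\<in>UNIV. \<Sum>d\<in>UNIV. \<Sum>b\<in>UNIV. \<Sum>c\<in>UNIV. ?v a b c d) =
      (\<Sum>a\<in>UNIV. if a * a = 1 then g (a + a) else 0)"
    by (simp add: sum.delta)
  also have "\<dots> = g 2 + g 9"
  proof -
    have "g 20 = g 9" by (rule arg_cong[of _ _ g]) simp
    then show ?thesis by (simp add: sum_11)
  qed
  finally have v: "(\<Sum>a\<in>UNIV. \<Sum>d\<in>UNIV. \<Sum>b\<in>UNIV. \<Sum>c\<in>UNIV. ?v a b c d) = g 2 + g 9" .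
  have "(\<Sum>a\<in>UNIV. \<Sum>d\<in>UNIV. \<Sum>b\<in>UNIV. \<Sum>c\<in>UNIV. ?w a b c d) + (g 2 + g 9) =
      (\<Sum>a\<in>UNIV. \<Sum>d\<in>UNIV. \<Sum>b\<in>UNIV. \<Sum>c\<in>UNIV. ?w a b c d + ?v a b c d)"
    unfolding v[symmetric] by (simp only: sum.distrib)
  also have "\<dots> = (\<Sum>a\<in>UNIV. \<Sum>d\<in>UNIV. \<Sum>b\<in>UNIV. \<Sum>c\<in>UNIV. g (a + d) * (if b * c = a * d - 1 then 1 else 0))"
    by (intro sum.cong refl) (auto simp: algebra_simps)
  also have "\<dots> = (\<Sum>a\<in>UNIV. \<Sum>d\<in>UNIV. g (a + d) * (if a * d - 1 = 0 then 21 else 10))"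
    by (simp only: sum_distrib_left[symmetric] count_products_11)
  \<comment> \<open>The trace \<open>t = a + d\<close> replaces \<open>d\<close> as summation
    variable.\<close>
  also have "\<dots> = (\<Sum>a\<in>UNIV. \<Sum>t\<in>UNIV. g t * (if a * (t - a) - 1 = 0 then 21 else 10))"
    by (intro sum.cong refl sum.reindex_bij_witness[where i = "\<lambda>t. t - a" and j = "\<lambda>d. a + d" for a]) auto
  also have "\<dots> = (\<Sum>t\<in>UNIV. g t * (\<Sum>a\<in>UNIV. if a * (t - a) - 1 = 0 then 21 else 10))"
    by (subst sum.swap) (simp only: sum_distrib_left)
  also have "\<dots> = 110 * g 0 + 110 * (g 1 + g 10) + 121 * (g 2 + g 9)
    + 132 * (g 3 + g 8) + 132 * (g 4 + g 7) + 110 * (g 5 + g 6)"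
    unfolding sum_11 by simp
  finally show ?thesis unfolding e by simp
qed

text \<open>Elements of order 6 count for both 2 and 3. The doubled exponents are 110 + 220 for 2,
  220 + 220 for 3, 264 + 264 for 5 and 240 for 11.\<close>

theorem Exp_rho_PSL_2_11: "Exp_rho PSL_2_11 = {120, 165, 220, 264}"
proof -
  interpret group PSL_2_11 by (rule group_PSL_2_11)
  have *: "ord_exponent p PSL_2_11 = (if p = 2 then 165 else if p = 3 then 220 else if p = 5 then 264
      else if p = 11 then 120 else 0)" if p: "prime p" for p :: nat
  proof -
    have pr: "prime (2::nat)" "prime (3::nat)" "prime (5::nat)" "prime (11::nat)" by simp_all
    have m: "multiplicity p q = (if p = q then 1 else 0)" if "prime q" for q
      using p that by (simp add: prime_multiplicity_other)
    have "multiplicity p 6 = multiplicity p (2 * 3)" by simp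
    also have "\<dots> = multiplicity p 2 + multiplicity p 3"
      using p by (intro prime_elem_multiplicity_mult_distrib) auto
    finally show ?thesis
      using ord_exponent_PSL[of p] m[OF pr(1)] m[OF pr(2)] m[OF pr(3)] m[OF pr(4)]
      by (auto simp: trace_order_def split: if_splits)
  qed
  show ?thesis
  proof (intro equalityI subsetI)
    fix n assume "n \<in> Exp_rho PSL_2_11"
    then obtain p where p: "prime p" "ord_exponent p PSL_2_11 = n" "n > 0"
      unfolding Exp_rho_eq[OF finite_PSL] by blast
    show "n \<in> {120, 165, 220, 264}"
      using *[OF p(1)] p(2,3) by (simp split: if_splits)
  next
    fix n :: nat assume n: "n \<in> {120, 165, 220, 264}"
    have mem: "m \<in> Exp_rho PSL_2_11" if "prime p" "ord_exponent p PSL_2_11 = m" "m > 0" for p m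
      unfolding Exp_rho_eq[OF finite_PSL] using that by blast
    have "165 \<in> Exp_rho PSL_2_11" by (rule mem[of 2]) (simp_all add: *)
    moreover have "220 \<in> Exp_rho PSL_2_11" by (rule mem[of 3]) (simp_all add: *)
    moreover have "264 \<in> Exp_rho PSL_2_11" by (rule mem[of 5]) (simp_all add: *)
    moreover have "120 \<in> Exp_rho PSL_2_11" by (rule mem[of 11]) (simp_all add: *)
    ultimately show "n \<in> Exp_rho PSL_2_11" using n by (elim insertE) simp_all
  qed
qed

section \<open>Isomorphism invariance and the characterization\<close>

lemma ord_iso:
  assumes "group G" "group H" "\<phi> \<in> iso G H" "x \<in> carrier G"
  shows "group.ord H (\<phi> x) = group.ord G x"
proof -
  interpret G: group G by fact
  interpret H: group H by fact
  have hom: "\<phi> \<in> hom G H" and inj: "inj_on \<phi> (carrier G)"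
    using assms(3) by (auto simp: iso_def bij_betw_def)
  have "\<phi> x [^]\<^bsub>H\<^esub> n = \<one>\<^bsub>H\<^esub> \<longleftrightarrow> x [^]\<^bsub>G\<^esub> n = \<one>\<^bsub>G\<^esub>" for n :: nat
  proof -
    have "\<phi> x [^]\<^bsub>H\<^esub> n = \<phi> (x [^]\<^bsub>G\<^esub> n)" using hom_nat_pow[OF hom assms(4,1,2)] by simp
    moreover have "\<one>\<^bsub>H\<^esub> = \<phi> \<one>\<^bsub>G\<^esub>" using hom_one[OF hom assms(1,2)] by simp
    ultimately show ?thesis
      using inj_on_eq_iff[OF inj G.nat_pow_closed[OF assms(4)] G.one_closed] by simp
  qed
  moreover have "\<phi> x \<in> carrier H" using hom assms(4) by (rule hom_carrier[THEN subsetD, OF _ imageI])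
  ultimately show ?thesis using assms(4) by (simp add: H.ord_unique G.pow_eq_id)
qed

lemma Exp_rho_cong_iso:
  assumes "group G" "group H" "G \<cong> H"
  shows "Exp_rho G = Exp_rho H"
proof -
  obtain \<phi> where \<phi>: "\<phi> \<in> iso G H" using assms(3) by (auto simp: is_iso_def)
  then have "bij_betw \<phi> (carrier G) (carrier H)" by (simp add: iso_def)
  then have "element_order_prod H = (\<Prod>x\<in>carrier G. group.ord H (\<phi> x))"
    unfolding element_order_prod_def by (rule prod.reindex_bij_betw[symmetric])
  also have "\<dots> = element_order_prod G"
    unfolding element_order_prod_def by (rule prod.cong) (simp_all add: ord_iso[OF assms(1,2) \<phi>])
  finally show ?thesis by (simp add: Exp_rho_def)
qed

theorem theorem2p8:
  fixes G :: "('a, 'b) monoid_scheme"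
  assumes "group G" and "finite (carrier G)"
  shows "G \<cong> PSL_2_11 \<longleftrightarrow> Exp_rho G = Exp_rho PSL_2_11"
proof
  assume "G \<cong> PSL_2_11"
  then show "Exp_rho G = Exp_rho PSL_2_11"
    by (rule Exp_rho_cong_iso[OF assms(1) group_PSL_2_11])
next
  assume "Exp_rho G = Exp_rho PSL_2_11"
  then have "G \<cong> projective_line_group"
    using Exp_rho_imp_iso[OF assms] Exp_rho_PSL_2_11 by simp
  \<comment> \<open>The same theorem, now with PSL(2,11) in the role of the group having the
    prescribed exponents.\<close>
  moreover have "projective_line_group \<cong> PSL_2_11"
    by (rule group.iso_sym[OF group_PSL_2_11 Exp_rho_imp_iso[OF group_PSL_2_11 finite_PSL Exp_rho_PSL_2_11]])
  ultimately show "G \<cong> PSL_2_11" by (rule iso_trans)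
qed

end
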